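(* Let $\Omega$ be a countably infinite set, $S=\mathrm{Sym}(\Omega)$, and let $\mathcal Q$ be the set of partitions $A$ of $\Omega$ for which there is a common finite bound on the cardinalities of the members of $A$ and such that infinitely many members of $A$ have cardinality $>1$. Then the subgroups $S_{(A)}$ with $A\in\mathcal Q$ are mutually $\approx$-equivalent, and a closed subgroup $G\le S$ is $\approx$-equivalent to these subgroups if and only if there exist a finite subset $\Gamma\subseteq\Omega$ and a positive integer $n$ such that all orbits of $G_{(\Gamma)}$ have cardinality at most $n$, but there is no finite $\Gamma\subseteq\Omega$ with $G_{(\Gamma)}=\{1\}$. Moreover, if $A\in\mathcal Q$ and $B$ is a partition of $\Omega$ into finite subsets with no common finite bound on the cardinalities of its members, then $S_{(A)}\prec S_{(B)}$.
   Context: $\mathrm{Sym}(\Omega)$ is the group of all permutations of $\Omega$ (acting on the right). $S$ carries the function topology (pointwise convergence, $\Omega$ discrete); "closed" means closed in $S$. For a partition $A$ of $\Omega$, $S_{(A)}=\{f\in S:\Sigma f=\Sigma\text{ for all }\Sigma\in A\}$. For $G\le S$ and $\Gamma\subseteq\Omega$, $G_{(\Gamma)}$ is the pointwise stabilizer of $\Gamma$ in $G$. For subgroups $G_1,G_2\le S$: $G_1\preccurlyeq G_2$ means there is a finite $U\subseteq S$ with $G_1\le\langle G_2\cup U\rangle$; $G_1\approx G_2$ means $G_1\preccurlyeq G_2$ and $G_2\preccurlyeq G_1$; $G_1\prec G_2$ means $G_1\preccurlyeq G_2$ and not $G_2\preccurlyeq G_1$. *)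

theory Defs
  imports Main "HOL-Library.Countable_Set"
begin

definition Sym :: "('a \<Rightarrow> 'a) set" where
  "Sym = {f. bij f}"

inductive_set gen :: "('a \<Rightarrow> 'a) set \<Rightarrow> ('a \<Rightarrow> 'a) set" for U where
  gen_id: "id \<in> gen U"
| gen_gen: "u \<in> U \<Longrightarrow> u \<in> gen U"
| gen_inv: "g \<in> gen U \<Longrightarrow> inv g \<in> gen U"
| gen_comp: "g \<in> gen U \<Longrightarrow> h \<in> gen U \<Longrightarrow> g \<circ> h \<in> gen U"

definition is_subgroup :: "('a \<Rightarrow> 'a) set \<Rightarrow> bool" where
  "is_subgroup G \<longleftrightarrow> G \<subseteq> Sym \<and> id \<in> G \<and>
     (\<forall>g\<in>G. \<forall>h\<in>G. g \<circ> h \<in> G) \<and> (\<forall>g\<in>G. inv g \<in> G)"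

text \<open>Closed in Sym with the topology of pointwise convergence (Omega discrete).\<close>
definition closed_in_Sym :: "('a \<Rightarrow> 'a) set \<Rightarrow> bool" where
  "closed_in_Sym G \<longleftrightarrow> (\<forall>f\<in>Sym. (\<forall>F. finite F \<longrightarrow> (\<exists>g\<in>G. \<forall>x\<in>F. g x = f x)) \<longrightarrow> f \<in> G)"

definition is_partition :: "'a set set \<Rightarrow> bool" where
  "is_partition A \<longleftrightarrow> {} \<notin> A \<and> \<Union>A = UNIV \<and>
     (\<forall>X\<in>A. \<forall>Y\<in>A. X \<noteq> Y \<longrightarrow> X \<inter> Y = {})"

definition S_part :: "'a set set \<Rightarrow> ('a \<Rightarrow> 'a) set" where
  "S_part A = {f\<in>Sym. \<forall>\<Sigma>\<in>A. f ` \<Sigma> = \<Sigma>}"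

definition pstab :: "('a \<Rightarrow> 'a) set \<Rightarrow> 'a set \<Rightarrow> ('a \<Rightarrow> 'a) set" where
  "pstab G \<Gamma> = {g\<in>G. \<forall>x\<in>\<Gamma>. g x = x}"

definition orbit :: "('a \<Rightarrow> 'a) set \<Rightarrow> 'a \<Rightarrow> 'a set" where
  "orbit H x = {h x | h. h \<in> H}"

definition preceq :: "('a \<Rightarrow> 'a) set \<Rightarrow> ('a \<Rightarrow> 'a) set \<Rightarrow> bool" where
  "preceq G1 G2 \<longleftrightarrow> (\<exists>U. finite U \<and> U \<subseteq> Sym \<and> G1 \<subseteq> gen (G2 \<union> U))"

definition approx :: "('a \<Rightarrow> 'a) set \<Rightarrow> ('a \<Rightarrow> 'a) set \<Rightarrow> bool" where
  "approx G1 G2 \<longleftrightarrow> preceq G1 G2 \<and> preceq G2 G1"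

definition prec :: "('a \<Rightarrow> 'a) set \<Rightarrow> ('a \<Rightarrow> 'a) set \<Rightarrow> bool" where
  "prec G1 G2 \<longleftrightarrow> preceq G1 G2 \<and> \<not> preceq G2 G1"

definition Qparts :: "'a set set set" where
  "Qparts = {A. is_partition A \<and> (\<exists>n::nat. \<forall>\<Sigma>\<in>A. finite \<Sigma> \<and> card \<Sigma> \<le> n)
              \<and> infinite {\<Sigma>\<in>A. card \<Sigma> > 1}}"

end

theory Submission
  imports Defs "HOL-Combinatorics.Transposition"
begin

text \<open>Everything is compared with one group: for an injective family of disjoint pairs whose union is
  co-infinite, the group of all products of transpositions of these pairs. All choices of the pairs
  give conjugate groups. An infinite supply of nontrivial blocks of \<open>A\<close> yields such a group inside
  \<open>S_part A\<close>. If the blocks of \<open>A\<close> are bounded, colour each block injectively with finitely many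
  colours; then every element of \<open>S_part A\<close> is a product of boundedly many involutions, each of
  which exchanges points of two fixed colours.

  If \<open>pstab G \<Gamma>\<close> has bounded orbits, then \<open>G\<close> lies below the flip group, because countably many coset
  representatives lie in a finitely generated group. For the converse relation pass to a stabilizer
  with the least possible orbit bound. By minimality there are points \<open>x i\<close> in distinct orbits which
  \<open>G\<close> moves independently of each other. Conjugating one fixed involution
  by \<open>G\<close> then gives arbitrary families of 3-cycles, from these come double transpositions, and a shift
  separates their two factors.

  If a closed group lies in a group generated by \<open>S_part A\<close> and finitely many permutations, it is a
  union of countably many sets of words of bounded length, each of which moves any point to boundedly
  many places; by Baire category one of them captures a coset of some \<open>pstab G \<Gamma>\<close>.\<close>

subsection \<open>Transport of permutations along injections\<close>

lemma gen_subset_Sym: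
  assumes "K \<subseteq> Sym" shows "gen K \<subseteq> Sym"
proof
  fix g assume "g \<in> gen K"
  then show "g \<in> Sym"
  proof induction
    case gen_id
    show ?case unfolding Sym_def using bij_id by blast
  next
    case (gen_gen u)
    then show ?case using assms by blast
  next
    case (gen_inv g)
    then show ?case unfolding Sym_def using bij_imp_bij_inv by blast
  next
    case (gen_comp g h)
    then show ?case unfolding Sym_def using bij_comp by blast
  qed
qed

lemma gen_least:
  assumes "K \<subseteq> gen L" shows "gen K \<subseteq> gen L"
proof
  fix g assume "g \<in> gen K"
  then show "g \<in> gen L"
  proof induction
    case gen_id
    show ?case by (rule gen.gen_id)
  next
    case (gen_gen u)
    then show ?case using assms by blast
  next
    case (gen_inv g)
    show ?case using gen_inv.IH by (rule gen.gen_inv)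
  next
    case (gen_comp g h)
    show ?case using gen_comp.IH by (rule gen.gen_comp)
  qed
qed

lemma gen_mono: "K \<subseteq> L \<Longrightarrow> gen K \<subseteq> gen L"
  by (rule gen_least) (auto intro: gen_gen)

lemma preceq_trans:
  assumes "preceq G1 G2" "preceq G2 G3" shows "preceq G1 G3"
proof -
  obtain U where U: "finite U" "U \<subseteq> Sym" "G1 \<subseteq> gen (G2 \<union> U)"
    using assms(1) by (auto simp: preceq_def)
  obtain V where V: "finite V" "V \<subseteq> Sym" "G2 \<subseteq> gen (G3 \<union> V)"
    using assms(2) by (auto simp: preceq_def)
  have "G2 \<union> U \<subseteq> gen (G3 \<union> (U \<union> V))"
    using V(3) gen_mono[of "G3 \<union> V" "G3 \<union> (U \<union> V)"] by (auto intro: gen_gen)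
  then have "G1 \<subseteq> gen (G3 \<union> (U \<union> V))"
    using gen_least U(3) by blast
  then show ?thesis
    unfolding preceq_def using U V by (intro exI[of _ "U \<union> V"]) auto
qed

lemma preceq_subset: "G1 \<subseteq> G2 \<Longrightarrow> preceq G1 G2"
  unfolding preceq_def by (intro exI[of _ "{}"]) (auto intro: gen_gen)

text \<open>Each level \<open>W k\<close> adds one round of inverses and products and stays
  countable; the levels exhaust the generated group. This later keeps a countable \<open>G\<close>
  from lying above the uncountable group \<open>S_part A\<close>.\<close>

lemma countable_gen:
  assumes "countable K" shows "countable (gen K)"
proof -
  define step :: "('a \<Rightarrow> 'a) set \<Rightarrow> ('a \<Rightarrow> 'a) set" where
    "step X = X \<union> inv ` X \<union> (\<lambda>(g, h). g \<circ> h) ` (X \<times> X)" for X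
  define W where "W k = (step ^^ k) (insert id K)" for k
  have W_Suc: "W (Suc k) = step (W k)" for k
    by (simp add: W_def)
  have "countable (W k)" for k
    by (induction k) (use assms in \<open>auto simp: W_def step_def\<close>)
  moreover have mono: "W i \<subseteq> W j" if "i \<le> j" for i j
    using that by (rule lift_Suc_mono_le[rotated]) (auto simp: W_Suc step_def)
  have "g \<in> (\<Union>k. W k)" if "g \<in> gen K" for g
    using that
  proof induction
    case gen_id
    have "id \<in> W 0" unfolding W_def by simp
    then show ?case by blast
  next
    case (gen_gen u)
    then have "u \<in> W 0" unfolding W_def by simp
    then show ?case by blast
  next
    case (gen_inv g)
    then obtain k where "g \<in> W k" by auto
    then have "inv g \<in> W (Suc k)" by (auto simp: W_Suc step_def)
    then show ?case by blast
  next
    case (gen_comp g h)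
    then obtain i j where ij: "g \<in> W i" "h \<in> W j" by auto
    have "(g, h) \<in> W (max i j) \<times> W (max i j)"
      using mono[of i "max i j"] mono[of j "max i j"] ij by auto
    then have "(\<lambda>(g, h). g \<circ> h) (g, h) \<in> W (Suc (max i j))"
      unfolding W_Suc step_def by blast
    then have "g \<circ> h \<in> W (Suc (max i j))" by simp
    then show ?case by blast
  qed
  ultimately show ?thesis
    by (meson countable_UN countable_subset countableI_type subsetI)
qed

text \<open>The label type may differ from \<Omega>, so that permutations can be designed on a
  structured index set such as \<open>nat \<times> int \<times> nat\<close> and then carried into
  \<Omega>.\<close>

definition transport :: "('x \<Rightarrow> 'a) \<Rightarrow> ('x \<Rightarrow> 'x) \<Rightarrow> 'a \<Rightarrow> 'a" where
  "transport p f y = (if y \<in> range p then p (f (inv p y)) else y)"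

lemma transport_apply [simp]: "inj p \<Longrightarrow> transport p f (p x) = p (f x)"
  by (simp add: transport_def)

lemma transport_outside: "y \<notin> range p \<Longrightarrow> transport p f y = y"
  by (simp add: transport_def)

lemma transport_eqI:
  assumes "inj p" "\<And>x. g (p x) = p (f x)" "\<And>y. y \<notin> range p \<Longrightarrow> g y = y"
  shows "transport p f = g"
proof
  fix y show "transport p f y = g y"
    by (cases "y \<in> range p") (use assms in \<open>auto simp: transport_outside\<close>)
qed

lemma transport_comp: "inj p \<Longrightarrow> transport p (f \<circ> g) = transport p f \<circ> transport p g"
  by (rule transport_eqI) (auto simp: transport_outside)

lemma transport_id: "inj p \<Longrightarrow> transport p id = id"
  by (rule transport_eqI) auto

lemma transport_bij:
  assumes "inj p" "bij f"
  shows "bij (transport p f)" "inv (transport p f) = transport p (inv f)"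
proof -
  have 1: "transport p f \<circ> transport p (inv f) = id"
    using assms by (metis bij_is_surj surj_iff transport_comp transport_id)
  have 2: "transport p (inv f) \<circ> transport p f = id"
    using assms by (metis bij_is_inj inv_o_cancel transport_comp transport_id)
  show "bij (transport p f)" using o_bij 1 2 by blast
  show "inv (transport p f) = transport p (inv f)" using inv_unique_comp 1 2 by blast
qed

lemma transport_transport:
  assumes "inj p" "inj r"
  shows "transport p (transport r f) = transport (p \<circ> r) f"
proof (rule sym, rule transport_eqI)
  show "transport p (transport r f) y = y" if "y \<notin> range (p \<circ> r)" for y
  proof (cases "y \<in> range p")
    case True
    then obtain x where "y = p x" by auto
    moreover from this that have "x \<notin> range r" by auto
    ultimately show ?thesis using assms by (simp add: transport_outside)
  qed (simp add: transport_outside)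
qed (use assms in \<open>auto simp: inj_compose\<close>)

lemma transport_conj:
  assumes "inj p" "bij v"
  shows "v \<circ> transport p f \<circ> inv v = transport (v \<circ> p) f"
proof (rule sym, rule transport_eqI)
  show "inj (v \<circ> p)" using assms by (simp add: bij_is_inj inj_compose)
  show "(v \<circ> transport p f \<circ> inv v) ((v \<circ> p) x) = (v \<circ> p) (f x)" for x
    using assms by (simp add: bij_is_inj)
  show "(v \<circ> transport p f \<circ> inv v) y = y" if "y \<notin> range (v \<circ> p)" for y
  proof -
    have "inv v y \<notin> range p"
      using that assms(2) by (metis bij_inv_eq_iff comp_apply imageE rangeI)
    then show ?thesis using assms(2) by (simp add: transport_outside bij_is_surj surj_f_inv_f)
  qed
qed

text \<open>Only the labels of moved points count: since \<open>f\<close> is injective,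
  \<open>f x\<close> is moved whenever \<open>x\<close> is, so \<open>p\<close> and \<open>q\<close>
  agree on the whole support of \<open>f\<close>. This tolerates a conjugating permutation that is
  uncontrolled off that support.\<close>

lemma transport_cong:
  assumes "inj p" "inj q" "inj f" "\<And>x. f x \<noteq> x \<Longrightarrow> p x = q x"
  shows "transport p f = transport q f"
proof (rule transport_eqI)
  have moved: "p (f x) = q (f x)" if "f x \<noteq> x" for x
    using that assms(3,4) by (simp add: inj_eq)
  show "transport q f (p x) = p (f x)" for x
  proof (cases "f x = x")
    case True
    have "transport q f y = y" if "\<And>x. f x \<noteq> x \<Longrightarrow> y \<noteq> q x" for y
      by (cases "y \<in> range q") (use that assms(2) in \<open>force simp: transport_outside\<close>)+
    moreover have "p x \<noteq> q x'" if "f x' \<noteq> x'" for x'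
      using assms(1) assms(4)[OF that] that True by (metis injD)
    ultimately show ?thesis using True by simp
  next
    case False
    then show ?thesis using assms moved by simp
  qed
  show "transport q f y = y" if "y \<notin> range p" for y
  proof (cases "y \<in> range q")
    case True
    then obtain x where x: "y = q x" by auto
    then have "f x = x" using that assms(4) by (metis rangeI)
    then show ?thesis using x assms by simp
  qed (simp add: transport_outside)
qed fact

lemma transport_gen:
  assumes "inj p" "K \<subseteq> Sym" "f \<in> gen K"
  shows "transport p f \<in> gen (transport p ` K)"
  using assms(3)
proof induction
  case gen_id
  show ?case using transport_id[OF assms(1)] gen.gen_id by metis
next
  case (gen_gen u)
  then show ?case by (simp add: gen.gen_gen)
next
  case (gen_inv g)
  then have "bij g" using gen_subset_Sym[OF assms(2)] by (auto simp: Sym_def)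
  then show ?case using transport_bij(2)[OF assms(1)] gen_inv gen.gen_inv by metis
next
  case (gen_comp g h)
  then show ?case unfolding transport_comp[OF assms(1)] by (intro gen.gen_comp)
qed

text \<open>\<open>Y - P\<close> and \<open>Y - Q\<close> are both countably infinite, so a
  bijection between them completes \<open>\<phi>\<close> to a permutation of \<open>Y\<close>.
  Taking \<open>Y = UNIV\<close> yields conjugators; smaller \<open>Y\<close> yield permutations
  supported in \<open>Y\<close>.\<close>

lemma extend_bij_betw:
  assumes "countable (UNIV :: 'a set)" and \<phi>: "bij_betw \<phi> P Q"
    and sub: "P \<subseteq> (Y :: 'a set)" "Q \<subseteq> Y" and inf: "infinite (Y - P)" "infinite (Y - Q)"
  obtains v where "bij v" "\<And>x. x \<in> P \<Longrightarrow> v x = \<phi> x" "\<And>x. x \<notin> Y \<Longrightarrow> v x = x"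
proof -
  have cnt: "countable X" for X :: "'a set"
    using countable_subset[OF subset_UNIV assms(1)] .
  obtain h where h: "bij_betw h (Y - P) (Y - Q)"
    using bij_betw_trans[OF to_nat_on_infinite[OF cnt inf(1)] bij_betw_from_nat_into[OF cnt inf(2)]]
    by blast
  define v where "v x = (if x \<in> P then \<phi> x else if x \<in> Y then h x else x)" for x
  have "bij_betw v P Q" using \<phi> by (rule bij_betw_cong[THEN iffD1, rotated]) (simp add: v_def)
  moreover have "bij_betw v (Y - P) (Y - Q)"
    using h by (rule bij_betw_cong[THEN iffD1, rotated]) (simp add: v_def)
  moreover have "bij_betw v (- Y) (- Y)"
    using sub by (auto simp: v_def bij_betw_def inj_on_def)
  ultimately have "bij_betw v (P \<union> (Y - P) \<union> - Y) (Q \<union> (Y - Q) \<union> - Y)"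
    using sub by (intro bij_betw_combine) auto
  moreover have "P \<union> (Y - P) \<union> - Y = UNIV" "Q \<union> (Y - Q) \<union> - Y = UNIV" using sub by auto
  ultimately have "bij v" by simp
  then show ?thesis by (rule that) (use sub in \<open>auto simp: v_def\<close>)
qed

lemma conjugator:
  fixes p q :: "'x \<Rightarrow> 'a"
  assumes "countable (UNIV :: 'a set)" "inj p" "inj q" "infinite (- range p)" "infinite (- range q)"
  obtains v where "bij v" "v \<circ> p = q"
proof -
  have "bij_betw (q \<circ> inv p) (range p) (range q)"
    using assms(2,3) by (intro bij_betw_trans[of "inv p" _ UNIV])
      (auto simp: bij_betw_def inj_on_inv_into)
  then obtain v where "bij v" "\<And>x. x \<in> range p \<Longrightarrow> v x = (q \<circ> inv p) x"
    using extend_bij_betw[OF assms(1), of "q \<circ> inv p" "range p" "range q" UNIV] assms(4,5)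
    by (metis Compl_eq_Diff_UNIV subset_UNIV)
  then show ?thesis using assms(2) by (intro that[of v]) auto
qed

section \<open>The comparison group of flips\<close>

definition flip :: "nat set \<Rightarrow> nat \<times> bool \<Rightarrow> nat \<times> bool" where
  "flip T = (\<lambda>(j, b). (j, if j \<in> T then \<not> b else b))"

text \<open>For injective \<open>q\<close> this is a copy of the full product of countably many
  groups of order two.\<close>

definition flips :: "(nat \<times> bool \<Rightarrow> 'a) \<Rightarrow> ('a \<Rightarrow> 'a) set" where
  "flips q = range (\<lambda>T. transport q (flip T))"

lemma flip_flip: "flip T \<circ> flip T = id"
  by (auto simp: flip_def)

lemma bij_flip: "bij (flip T)"
  using flip_flip o_bij by blast

text \<open>\<open>T\<close> can be read off the images of the points \<open>q (j, True)\<close>, so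
  there are as many flips as sets of naturals.\<close>

lemma uncountable_flips:
  assumes "inj q" shows "uncountable (flips q)"
proof -
  have "inj (\<lambda>T. transport q (flip T))"
  proof (rule injI)
    fix S T assume eq: "transport q (flip S) = transport q (flip T)"
    have "q (flip S (j, True)) = q (flip T (j, True))" for j
      using assms transport_apply eq by metis
    then have *: "flip S (j, True) = flip T (j, True)" for j using assms by (simp add: inj_eq)
    have "j \<in> S \<longleftrightarrow> j \<in> T" for j
      using *[of j] by (simp add: flip_def split: if_splits)
    then show "S = T" by blast
  qed
  moreover have "uncountable (UNIV :: nat set set)"
    unfolding uncountable_def using Cantors_theorem[of "UNIV :: nat set"] by (metis Pow_UNIV UNIV_not_empty)
  ultimately show ?thesis
    unfolding flips_def using countable_image_inj_on by blast
qed

text \<open>Co-infinite ranges allow a permutation \<open>v\<close> of \<Omega> with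
  \<open>v \<circ> q = r\<close>; conjugation by this single new generator turns the flips of
  \<open>q\<close> into those of \<open>r\<close>.\<close>

lemma flips_conj:
  fixes q r :: "nat \<times> bool \<Rightarrow> 'a"
  assumes "countable (UNIV :: 'a set)" "inj q" "inj r" "infinite (- range q)" "infinite (- range r)"
  shows "preceq (flips r) (flips q)"
proof -
  obtain v where v: "bij v" "v \<circ> q = r" using conjugator assms by metis
  have "transport r (flip T) \<in> gen (flips q \<union> {v})" for T
  proof -
    have "transport r (flip T) = v \<circ> transport q (flip T) \<circ> inv v"
      using transport_conj[OF assms(2) v(1)] v(2) by simp
    moreover have "transport q (flip T) \<in> gen (flips q \<union> {v})" "v \<in> gen (flips q \<union> {v})"
      by (auto simp: flips_def intro: gen_gen)
    ultimately show ?thesis by (simp add: gen_comp gen_inv)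
  qed
  then show ?thesis
    unfolding preceq_def using v by (intro exI[of _ "{v}"]) (auto simp: flips_def Sym_def)
qed

subsection \<open>Partitions with bounded blocks\<close>

lemma S_part_invI:
  assumes "bij f" "f \<circ> f = id" "\<And>\<Sigma> y. \<Sigma> \<in> A \<Longrightarrow> y \<in> \<Sigma> \<Longrightarrow> f y \<in> \<Sigma>"
  shows "f \<in> S_part A"
proof -
  have "f ` \<Sigma> = \<Sigma>" if "\<Sigma> \<in> A" for \<Sigma>
  proof
    show "f ` \<Sigma> \<subseteq> \<Sigma>" using assms(3) that by blast
    show "\<Sigma> \<subseteq> f ` \<Sigma>"
    proof
      fix y assume "y \<in> \<Sigma>"
      then have "f y \<in> \<Sigma>" using assms(3) that by blast
      moreover have "f (f y) = y" using assms(2) by (metis comp_apply id_apply)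
      ultimately show "y \<in> f ` \<Sigma>" by (metis image_eqI)
    qed
  qed
  then show ?thesis using assms(1) by (simp add: S_part_def Sym_def)
qed

lemma S_part_comp:
  assumes "f \<in> S_part A" "g \<in> S_part A" shows "f \<circ> g \<in> S_part A"
proof -
  have "(f \<circ> g) ` \<Sigma> = \<Sigma>" if "\<Sigma> \<in> A" for \<Sigma>
    unfolding image_comp[symmetric] using assms that by (simp add: S_part_def)
  then show ?thesis using assms by (simp add: S_part_def Sym_def bij_comp)
qed

lemma flips_subset_S_part:
  assumes "is_partition B" "infinite {\<Sigma> \<in> B. card \<Sigma> > 1}"
  obtains q where "inj q" "infinite (- range q)" "flips q \<subseteq> S_part B"
proof -
  obtain \<Sigma> :: "nat \<Rightarrow> 'a set" where \<Sigma>: "inj \<Sigma>" "range \<Sigma> \<subseteq> {\<Sigma> \<in> B. card \<Sigma> > 1}"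
    using infinite_countable_subset[OF assms(2)] by blast
  have \<Sigma>B: "\<Sigma> i \<in> B" and \<Sigma>card: "card (\<Sigma> i) > 1" for i using \<Sigma>(2) by auto
  have "\<exists>x y. x \<in> \<Sigma> i \<and> y \<in> \<Sigma> i \<and> x \<noteq> y" for i
    using \<Sigma>card[of i] by (metis card_1_singleton_iff card.empty card_le_Suc0_iff_eq card.infinite
        less_one linorder_not_le One_nat_def not_less_zero)
  then obtain a b where ab: "\<And>i. a i \<in> \<Sigma> i" "\<And>i. b i \<in> \<Sigma> i" "\<And>i. a i \<noteq> b i" by metis
  have uniq: "X = Y" if "X \<in> B" "Y \<in> B" "x \<in> X" "x \<in> Y" for X Y x
    using assms(1) that unfolding is_partition_def by blast
  have ij: "i = j" if "x \<in> \<Sigma> i" "x \<in> \<Sigma> j" for i j x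
    using uniq[OF \<Sigma>B \<Sigma>B that] \<Sigma>(1) by (simp add: inj_eq)
  \<comment> \<open>Only every other chosen block is used; the points \<open>a (2 * j + 1)\<close>
    of the remaining ones make the complement of the range infinite.\<close>
  define q where "q = (\<lambda>(j, t). if t then a (2 * j) else b (2 * j))"
  have q_in: "q (j, t) \<in> \<Sigma> (2 * j)" for j t using ab by (simp add: q_def)
  have "inj q"
  proof (rule injI)
    fix u v assume eq: "q u = q v"
    obtain i s j t where uv: "u = (i, s)" "v = (j, t)" by fastforce
    have "2 * i = 2 * j" using ij q_in eq uv by metis
    then have "i = j" by simp
    moreover have "s = t" using eq ab(3)[of "2 * i"] ab(3)[of "2 * i", symmetric] \<open>i = j\<close> uv
      by (auto simp: q_def split: if_splits)
    ultimately show "u = v" using uv by simp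
  qed
  moreover have "infinite (- range q)"
  proof
    assume "finite (- range q)"
    moreover have "range (\<lambda>j. a (2 * j + 1)) \<subseteq> - range q"
    proof clarify
      fix i j t assume eq: "a (2 * i + 1) = q (j, t)"
      have "2 * i + 1 = 2 * j" using ij ab(1) q_in eq by metis
      then show False by presburger
    qed
    moreover have "inj (\<lambda>j. a (2 * j + 1))"
    proof (rule injI)
      fix i j assume "a (2 * i + 1) = a (2 * j + 1)"
      then have "2 * i + 1 = 2 * j + 1" using ij ab(1) by metis
      then show "i = j" by simp
    qed
    ultimately show False using finite_subset range_inj_infinite by blast
  qed
  moreover have "transport q (flip T) \<in> S_part B" for T
  proof (rule S_part_invI)
    show "bij (transport q (flip T))" using transport_bij bij_flip \<open>inj q\<close> by blast
    show "transport q (flip T) \<circ> transport q (flip T) = id"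
      using transport_comp[OF \<open>inj q\<close>] flip_flip transport_id[OF \<open>inj q\<close>] by metis
    show "transport q (flip T) y \<in> X" if "X \<in> B" "y \<in> X" for X y
    proof (cases "y \<in> range q")
      case True
      then obtain j t where y: "y = q (j, t)" by auto
      then have "X = \<Sigma> (2 * j)" using uniq \<Sigma>B q_in that by metis
      then show ?thesis using q_in y \<open>inj q\<close> by (simp add: flip_def)
    qed (use that in \<open>simp add: transport_outside\<close>)
  qed
  ultimately show ?thesis using that by (auto simp: flips_def)
qed

section \<open>Permutations of bounded blocks as products of involutions\<close>

definition swap_along :: "('a \<Rightarrow> 'a) \<Rightarrow> 'a set \<Rightarrow> 'a \<Rightarrow> 'a" where
  "swap_along \<pi> E y = (if y \<in> E then \<pi> y else if y \<in> \<pi> ` E then inv_into E \<pi> y else y)"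

lemma swap_along_simps:
  assumes "inj_on \<pi> E" "\<pi> ` E \<inter> E = {}"
  shows "x \<in> E \<Longrightarrow> swap_along \<pi> E x = \<pi> x" "x \<in> E \<Longrightarrow> swap_along \<pi> E (\<pi> x) = x"
    and "y \<notin> E \<Longrightarrow> y \<notin> \<pi> ` E \<Longrightarrow> swap_along \<pi> E y = y"
  using assms by (auto simp: swap_along_def)

lemma swap_along_involution:
  assumes "inj_on \<pi> E" "\<pi> ` E \<inter> E = {}"
  shows "swap_along \<pi> E \<circ> swap_along \<pi> E = id"
proof
  note s = swap_along_simps[OF assms]
  fix y
  consider "y \<in> E" | x where "x \<in> E" "y = \<pi> x" | "y \<notin> E" "y \<notin> \<pi> ` E" by blast
  then show "(swap_along \<pi> E \<circ> swap_along \<pi> E) y = id y"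
    by cases (simp_all add: s)
qed

text \<open>One finite \<open>U\<close> has to serve all \<open>E\<close> at once. The pairs
  \<open>x\<close>, \<open>\<pi> x\<close> may exhaust \<Omega>, so they are split into two
  families, each with co-infinite union and hence conjugate to the pairs of \<open>q\<close>. Each
  involution is then a product of one flip from either family.\<close>

lemma swap_along_preceq_flips:
  fixes q :: "nat \<times> bool \<Rightarrow> 'a"
  assumes cnt: "countable (UNIV :: 'a set)" and q: "inj q" "infinite (- range q)"
    and \<pi>: "inj_on \<pi> D" "\<pi> ` D \<inter> D = {}"
  shows "\<exists>U. finite U \<and> U \<subseteq> Sym \<and> (\<forall>E\<subseteq>D. swap_along \<pi> E \<in> gen (flips q \<union> U))"
proof -
  have \<pi>E: "inj_on \<pi> E" "\<pi> ` E \<inter> E = {}" if "E \<subseteq> D" for E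
    using \<pi> that inj_on_subset by blast+
  note s = swap_along_simps[OF \<pi>E]
  show ?thesis
  proof (cases "finite D")
    case True
    \<comment> \<open>A finite \<open>D\<close> has finitely many subsets, so all the involutions
      themselves can be taken as generators.\<close>
    have "swap_along \<pi> E \<in> Sym" if "E \<subseteq> D" for E
      unfolding Sym_def using swap_along_involution[OF \<pi>E[OF that]] o_bij by blast
    with True show ?thesis
      by (intro exI[of _ "swap_along \<pi> ` Pow D"]) (auto intro: gen_gen)
  next
    case False
    have "countable D" using countable_subset[OF subset_UNIV cnt] .
    from bij_betw_from_nat_into[OF this False]
    obtain d :: "nat \<Rightarrow> 'a" where d: "bij_betw d UNIV D" by blast
    have dD: "d i \<in> D" for i using d bij_betwE by blast
    have d_eq: "d i = d j \<longleftrightarrow> i = j" for i j using d by (simp add: bij_betw_def inj_eq)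
    have \<pi>d_eq: "\<pi> (d i) = \<pi> (d j) \<longleftrightarrow> i = j" for i j
      using \<pi>(1) dD d_eq by (metis inj_onD)
    have \<pi>d_neq: "\<pi> (d i) \<noteq> d j" "d j \<noteq> \<pi> (d i)" for i j
      using \<pi>(2) dD by (metis disjoint_iff image_eqI)+
    \<comment> \<open>\<open>c\<close> is the parity of the index. In the proof of co-infinity,
      \<open>1 - c\<close> is the opposite parity, whose points stay free.\<close>
    define r where "r c = (\<lambda>(j, t). if t then d (2 * j + c) else \<pi> (d (2 * j + c)))" for c :: nat
    have r_inj: "inj (r c)" for c
      by (rule injI) (auto simp: r_def d_eq \<pi>d_eq \<pi>d_neq split: if_splits)
    have r_coinf: "infinite (- range (r c))" if "c < 2" for c
    proof
      assume "finite (- range (r c))"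
      moreover have "range (\<lambda>j. d (2 * j + (1 - c))) \<subseteq> - range (r c)"
      proof clarify
        fix i j t assume "d (2 * i + (1 - c)) = r c (j, t)"
        then have "2 * i + (1 - c) = 2 * j + c"
          by (auto simp: r_def d_eq \<pi>d_neq split: if_splits)
        then show False using that by presburger
      qed
      moreover have "inj (\<lambda>j. d (2 * j + (1 - c)))"
        by (rule injI) (simp add: d_eq)
      ultimately show False using finite_subset range_inj_infinite by blast
    qed
    have "preceq (flips (r c)) (flips q)" if "c < 2" for c
      using flips_conj[OF cnt q(1) r_inj q(2) r_coinf[OF that]] .
    then have "\<exists>U. finite U \<and> U \<subseteq> Sym \<and> flips (r c) \<subseteq> gen (flips q \<union> U)" if "c < 2" for c
      using that by (simp add: preceq_def)
    then obtain U0 U1 where U: "finite U0" "U0 \<subseteq> Sym" "flips (r 0) \<subseteq> gen (flips q \<union> U0)"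
        "finite U1" "U1 \<subseteq> Sym" "flips (r 1) \<subseteq> gen (flips q \<union> U1)"
      by (metis one_less_numeral_iff semiring_norm(76) zero_less_numeral)
    let ?K = "flips q \<union> (U0 \<union> U1)"
    have sub: "flips (r 0) \<subseteq> gen ?K" "flips (r 1) \<subseteq> gen ?K"
      by (rule order_trans[OF U(3)], rule gen_mono, blast)
        (rule order_trans[OF U(6)], rule gen_mono, blast)
    have "swap_along \<pi> E \<in> gen ?K" if E: "E \<subseteq> D" for E
    proof -
      define T where "T c = {j. d (2 * j + c) \<in> E}" for c
      have on_d: "transport (r c) (flip (T c)) (d i)
          = (if i mod 2 = c \<and> d i \<in> E then \<pi> (d i) else d i)" (is ?A)
        and on_\<pi>d: "transport (r c) (flip (T c)) (\<pi> (d i))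
          = (if i mod 2 = c \<and> d i \<in> E then d i else \<pi> (d i))" (is ?B) if "c < 2" for c i
      proof -
        have "?A \<and> ?B"
        proof (cases "i mod 2 = c")
          case True
          then obtain j where i: "i = 2 * j + c" by (metis mult_div_mod_eq)
          have "d i = r c (j, True)" "\<pi> (d i) = r c (j, False)" by (simp_all add: r_def i)
          then have "transport (r c) (flip (T c)) (d i) = r c (flip (T c) (j, True))"
            "transport (r c) (flip (T c)) (\<pi> (d i)) = r c (flip (T c) (j, False))"
            using transport_apply[OF r_inj] by metis+
          moreover have "r c (flip (T c) (j, True)) = (if d i \<in> E then \<pi> (d i) else d i)"
            "r c (flip (T c) (j, False)) = (if d i \<in> E then d i else \<pi> (d i))"
            by (simp_all add: flip_def T_def r_def i)
          ultimately show ?thesis using True by presburger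
        next
          case False
          have "i \<noteq> 2 * j + c" for j using False that by auto
          then have "d i \<notin> range (r c)" "\<pi> (d i) \<notin> range (r c)"
            by (auto simp: r_def d_eq \<pi>d_eq \<pi>d_neq split: if_splits)
          then show ?thesis using False by (simp add: transport_outside)
        qed
        then show ?A ?B by auto
      qed
      have "swap_along \<pi> E = transport (r 0) (flip (T 0)) \<circ> transport (r 1) (flip (T 1))"
      proof
        fix y
        have D: "D = range d" using d by (simp add: bij_betw_def)
        consider i where "y = d i" | i where "y = \<pi> (d i)" | "y \<notin> D" "y \<notin> \<pi> ` D"
          unfolding D by blast
        then show "swap_along \<pi> E y = (transport (r 0) (flip (T 0)) \<circ> transport (r 1) (flip (T 1))) y"
        proof cases
          case (1 i)
          have "d i \<notin> \<pi> ` E" using E \<pi>(2) dD by blast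
          then show ?thesis
            using 1 E by (cases "d i \<in> E") (auto simp: on_d on_\<pi>d s)
        next
          case (2 i)
          have "\<pi> (d i) \<notin> E" using E \<pi>(2) dD by blast
          moreover have "\<pi> (d i) \<in> \<pi> ` E \<longleftrightarrow> d i \<in> E"
            using inj_on_image_mem_iff[OF \<pi>(1) dD E] .
          ultimately show ?thesis
            using 2 E by (cases "d i \<in> E") (auto simp: on_d on_\<pi>d s)
        next
          case 3
          then have "y \<notin> range (r c)" for c using dD by (auto simp: r_def split: if_splits)
          moreover have "y \<notin> E" "y \<notin> \<pi> ` E" using 3 E by auto
          ultimately show ?thesis using E by (simp add: transport_outside s)
        qed
      qed
      moreover have "transport (r 0) (flip (T 0)) \<in> gen ?K" "transport (r 1) (flip (T 1)) \<in> gen ?K"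
        using sub by (auto simp: flips_def)
      ultimately show ?thesis by (metis gen_comp)
    qed
    then show ?thesis using U by (intro exI[of _ "U0 \<union> U1"]) auto
  qed
qed

text \<open>Blocks are coloured injectively with colours below \<open>n\<close>, and
  \<open>f\<close> is reduced to the identity as in sorting. Colours are treated from the highest
  down; for colour \<open>m\<close>, the moves to colour 0, then 1, up to \<open>m - 1\<close> are
  undone in turn, each by one swap between two colours. Only the finitely many pairs
  \<open>j < m < n\<close> occur, so finitely many extra generators suffice.\<close>

lemma S_part_preceq_flips:
  fixes q :: "nat \<times> bool \<Rightarrow> 'a"
  assumes cnt: "countable (UNIV :: 'a set)" and q: "inj q" "infinite (- range q)"
    and A: "is_partition A" and bound: "\<And>\<Sigma>. \<Sigma> \<in> A \<Longrightarrow> finite \<Sigma> \<and> card \<Sigma> \<le> n"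
  shows "preceq (S_part A) (flips q)"
proof -
  define rel where "rel x y \<longleftrightarrow> (\<exists>\<Sigma>\<in>A. x \<in> \<Sigma> \<and> y \<in> \<Sigma>)" for x y
  have uniq: "X = Y" if "X \<in> A" "Y \<in> A" "x \<in> X" "x \<in> Y" for X Y x
    using A that unfolding is_partition_def by blast
  have rel_sym: "rel y x" if "rel x y" for x y using that by (auto simp: rel_def)
  have rel_trans: "rel x z" if "rel x y" "rel y z" for x y z
    using that uniq unfolding rel_def by metis
  have rel_f: "rel x (f x)" if "f \<in> S_part A" for f x
  proof -
    obtain \<Sigma> where "\<Sigma> \<in> A" "x \<in> \<Sigma>" using A unfolding is_partition_def by blast
    moreover have "f ` \<Sigma> = \<Sigma>" using that \<open>\<Sigma> \<in> A\<close> by (simp add: S_part_def)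
    ultimately show ?thesis unfolding rel_def by blast
  qed
  have "\<exists>e. bij_betw e \<Sigma> {0..<card \<Sigma>}" if "\<Sigma> \<in> A" for \<Sigma>
    using ex_bij_betw_finite_nat bound that by blast
  then obtain c where c: "\<And>\<Sigma>. \<Sigma> \<in> A \<Longrightarrow> bij_betw (c \<Sigma>) \<Sigma> {0..<card \<Sigma>}" by metis
  define e where "e x = c (THE \<Sigma>. \<Sigma> \<in> A \<and> x \<in> \<Sigma>) x" for x
  have e_eq: "e x = c \<Sigma> x" if "\<Sigma> \<in> A" "x \<in> \<Sigma>" for x \<Sigma>
    unfolding e_def using the_equality[of "\<lambda>\<Sigma>. \<Sigma> \<in> A \<and> x \<in> \<Sigma>" \<Sigma>] that uniq by metis
  have e_inj: "x = y" if "rel x y" "e x = e y" for x y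
    using that c e_eq unfolding rel_def bij_betw_def by (metis inj_onD)
  have e_less: "e x < n" for x
  proof -
    obtain \<Sigma> where \<Sigma>: "\<Sigma> \<in> A" "x \<in> \<Sigma>" using A unfolding is_partition_def by blast
    then have "c \<Sigma> x < card \<Sigma>" using bij_betwE[OF c] by fastforce
    then show ?thesis using \<Sigma> e_eq bound by (metis order_less_le_trans)
  qed
  define D where "D m j = {x. e x = m \<and> (\<exists>y. rel x y \<and> e y = j)}" for m j
  \<comment> \<open>The choice is forced, because a block has at most one point of each colour; see
    \<open>\<pi>_eq\<close>.\<close>
  define \<pi> where "\<pi> j x = (SOME y. rel x y \<and> e y = j)" for j x
  have \<pi>: "rel x (\<pi> j x) \<and> e (\<pi> j x) = j" if "x \<in> D m j" for x m j
    using that unfolding D_def \<pi>_def by (auto intro: someI2)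
  have \<pi>_eq: "\<pi> j x = y" if "rel x y" "e y = j" for x y j
  proof -
    have "x \<in> D (e x) j" using that by (auto simp: D_def)
    from \<pi>[OF this] show ?thesis using that rel_sym rel_trans e_inj by metis
  qed
  have \<pi>_inj: "inj_on (\<pi> j) (D m j)" for m j
  proof (rule inj_onI)
    fix x y assume "x \<in> D m j" "y \<in> D m j" "\<pi> j x = \<pi> j y"
    moreover from this have "rel x y" using \<pi> rel_sym rel_trans by metis
    moreover have "e x = e y" using calculation by (simp add: D_def)
    ultimately have "rel x y" "e x = e y" by simp_all
    then show "x = y" by (rule e_inj)
  qed
  have \<pi>_disj: "\<pi> j ` D m j \<inter> D m j = {}" if "j < m" for m j
    using that \<pi> by (fastforce simp: D_def)
  define U where "U m j = (SOME U. finite U \<and> U \<subseteq> Sym \<and>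
    (\<forall>E\<subseteq>D m j. swap_along (\<pi> j) E \<in> gen (flips q \<union> U)))" for m j
  have "finite (U m j) \<and> U m j \<subseteq> Sym \<and>
      (\<forall>E\<subseteq>D m j. swap_along (\<pi> j) E \<in> gen (flips q \<union> U m j))" if "j < m" for m j
    unfolding U_def
    using someI_ex[OF swap_along_preceq_flips[OF cnt q \<pi>_inj \<pi>_disj[OF that]]] .
  then have U: "\<And>m j. j < m \<Longrightarrow> finite (U m j)" "\<And>m j. j < m \<Longrightarrow> U m j \<subseteq> Sym"
      "\<And>m j E. j < m \<Longrightarrow> E \<subseteq> D m j \<Longrightarrow> swap_along (\<pi> j) E \<in> gen (flips q \<union> U m j)"
    by blast+
  define V where "V = (\<Union>m<n. \<Union>j<m. U m j)"
  have V: "finite V" "V \<subseteq> Sym" using U(1,2) by (auto simp: V_def) blast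
  let ?K = "flips q \<union> V"
  have swapK: "swap_along (\<pi> j) E \<in> gen ?K" if "j < m" "m < n" "E \<subseteq> D m j" for j m E
  proof -
    have "flips q \<union> U m j \<subseteq> ?K" using that by (auto simp: V_def)
    from gen_mono[OF this] show ?thesis using U(3)[OF that(1,3)] by blast
  qed
  have fixed_above: "f \<in> gen ?K" if "m \<le> n" "f \<in> S_part A" "\<forall>x. e x \<ge> m \<longrightarrow> f x = x" for f m
    using that
  proof (induction m arbitrary: f)
    case 0
    then have "f = id" by auto
    then show ?case using gen_id by metis
  next
    case (Suc m)
    \<comment> \<open>Inner induction, downwards in \<open>k\<close>: \<open>?P k\<close> treats
      those \<open>f\<close> that send no point of colour \<open>m\<close> below colour
      \<open>k\<close>. \<open>?P m\<close> follows from the outer hypothesis, and in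
      \<open>?P 0\<close> the restriction is empty.\<close>
    let ?P = "\<lambda>k. \<forall>f. f \<in> S_part A \<longrightarrow> (\<forall>x. e x \<ge> Suc m \<longrightarrow> f x = x) \<longrightarrow>
      (\<forall>x. e x = m \<longrightarrow> e (f x) \<ge> k) \<longrightarrow> f \<in> gen ?K"
    have "?P 0"
    proof (rule inc_induct[of 0 m ?P])
      show "?P m"
      proof (intro allI impI)
        fix f assume f: "f \<in> S_part A" "\<forall>x. e x \<ge> Suc m \<longrightarrow> f x = x" "\<forall>x. e x = m \<longrightarrow> e (f x) \<ge> m"
        have inj: "inj f" using f(1) by (simp add: S_part_def Sym_def bij_is_inj)
        have "f x = x" if "e x = m" for x
        proof (cases "e (f x) = m")
          case True
          then show ?thesis using e_inj[OF rel_f[OF f(1)]] that by metis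
        next
          case False
          \<comment> \<open>Points of higher colour are already fixed, so \<open>f x\<close> is its
            own image and injectivity gives \<open>f x = x\<close>.\<close>
          then have "e (f x) \<ge> Suc m" using f(3) that by (metis le_antisym not_less_eq_eq)
          then have "f (f x) = f x" using f(2) by blast
          then show ?thesis using inj by (simp add: inj_eq)
        qed
        then have "\<forall>x. e x \<ge> m \<longrightarrow> f x = x" using f(2) by (metis le_antisym not_less_eq_eq)
        then show "f \<in> gen ?K" using Suc.IH f(1) Suc.prems(1) by simp
      qed
    next
      fix k assume k: "0 \<le> k" "k < m" and IH: "?P (Suc k)"
      show "?P k"
      proof (intro allI impI)
        fix f assume f: "f \<in> S_part A" "\<forall>x. e x \<ge> Suc m \<longrightarrow> f x = x" "\<forall>x. e x = m \<longrightarrow> e (f x) \<ge> k"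
        have f_bij: "bij f" using f(1) by (simp add: S_part_def Sym_def)
        \<comment> \<open>These points violate the bound \<open>Suc k\<close>. Swapping them with
          their images after \<open>f\<close> makes them fixed and leaves the images of the other
          points of colour \<open>m\<close> alone.\<close>
        define E where "E = {x. e x = m \<and> e (f x) = k}"
        have E: "E \<subseteq> D m k" using rel_f[OF f(1)] by (auto simp: E_def D_def)
        have \<pi>f: "\<pi> k x = f x" if "x \<in> E" for x
          using that by (intro \<pi>_eq rel_f[OF f(1)]) (simp add: E_def)
        have E\<pi>: "inj_on (\<pi> k) E" "\<pi> k ` E \<inter> E = {}"
          using \<pi>_inj \<pi>_disj[OF k(2)] E inj_on_subset by blast+
        let ?s = "swap_along (\<pi> k) E"
        have s1: "?s x = f x" "?s (f x) = x" if "x \<in> E" for x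
          using swap_along_simps(1,2)[OF E\<pi> that] \<pi>f[OF that] by simp_all
        have s2: "?s y = y" if "y \<notin> E" "y \<notin> f ` E" for y
        proof -
          have "\<pi> k ` E = f ` E" using \<pi>f by (intro image_cong refl)
          then show ?thesis using swap_along_simps(3)[OF E\<pi>] that by simp
        qed
        have ss: "?s \<circ> ?s = id" using swap_along_involution[OF E\<pi>] .
        then have s_bij: "bij ?s" using o_bij by blast
        have "?s \<in> S_part A"
        proof (rule S_part_invI[OF s_bij ss])
          fix \<Sigma> y assume y: "\<Sigma> \<in> A" "y \<in> \<Sigma>"
          have f\<Sigma>: "f ` \<Sigma> = \<Sigma>" using f(1) y(1) by (simp add: S_part_def)
          consider "y \<in> E" | x where "x \<in> E" "y = f x" | "y \<notin> E" "y \<notin> f ` E" by blast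
          then show "?s y \<in> \<Sigma>"
          proof cases
            case 1
            then show ?thesis using s1 f\<Sigma> y by auto
          next
            case (2 x)
            then have "f x \<in> f ` \<Sigma>" using f\<Sigma> y by simp
            then have "x \<in> \<Sigma>" using f_bij by (simp add: bij_is_inj inj_image_mem_iff)
            then show ?thesis using 2 s1 by simp
          qed (simp add: s2 y)
        qed
        then have sf: "?s \<circ> f \<in> S_part A"
          using f(1) by (rule S_part_comp)
        have "?s \<circ> f \<in> gen ?K"
        proof (rule IH[rule_format, OF sf])
          fix x assume x: "Suc m \<le> e x"
          then have "f x = x" using f(2) by blast
          moreover have "x \<notin> E" "x \<notin> f ` E" using x k by (auto simp: E_def)
          ultimately show "(?s \<circ> f) x = x" using s2 by simp
        next
          fix x assume x: "e x = m"
          show "Suc k \<le> e ((?s \<circ> f) x)"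
          proof (cases "x \<in> E")
            case True
            then show ?thesis using s1 x k by simp
          next
            case False
            then have "Suc k \<le> e (f x)" using f(3) x by (auto simp: E_def le_neq_implies_less Suc_le_eq)
            moreover have "f x \<notin> f ` E" using False f_bij by (simp add: bij_is_inj inj_image_mem_iff)
            moreover have "f x \<notin> E"
            proof
              assume "f x \<in> E"
              then have "e x = e (f x)" using x by (simp add: E_def)
              then have "x = f x" by (rule e_inj[OF rel_f[OF f(1)]])
              then show False using \<open>f x \<in> E\<close> False by simp
            qed
            ultimately show ?thesis using s2 by simp
          qed
        qed
        moreover have "?s \<in> gen ?K" using swapK[OF k(2) _ E] Suc.prems(1) by simp
        ultimately have "?s \<circ> (?s \<circ> f) \<in> gen ?K" by (rule gen_comp[rotated])
        then show "f \<in> gen ?K" using ss by (simp add: comp_assoc[symmetric])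
      qed
    qed simp
    then show ?case using Suc.prems by auto
  qed
  have "S_part A \<subseteq> gen ?K"
    using fixed_above[of n] e_less by (auto simp: not_le[symmetric])
  then show ?thesis unfolding preceq_def using V by blast
qed

subsection \<open>Countable sets of permutations\<close>

lemma ex_inj_coinfinite:
  assumes "countable (UNIV :: 'x set)" "countable (UNIV :: 'a set)" "infinite (UNIV :: 'a set)"
  obtains p :: "'x \<Rightarrow> 'a" where "inj p" "infinite (- range p)"
proof -
  obtain d :: "nat \<Rightarrow> 'a" where d: "bij d"
    using bij_betw_from_nat_into[OF assms(2,3)] by blast
  have d_eq: "d i = d j \<longleftrightarrow> i = j" for i j using d by (simp add: bij_def inj_eq)
  obtain c :: "'x \<Rightarrow> nat" where c: "inj c" using assms(1) by (auto simp: countable_def)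
  let ?p = "\<lambda>x. d (2 * c x)"
  have "inj ?p" using c by (auto simp: inj_def d_eq)
  moreover have "infinite (- range ?p)"
  proof
    assume "finite (- range ?p)"
    moreover have "range (\<lambda>j. d (2 * j + 1)) \<subseteq> - range ?p"
    proof clarify
      fix i x assume "d (2 * i + 1) = d (2 * c x)"
      then have "2 * i + 1 = 2 * c x" using d_eq by blast
      then show False by presburger
    qed
    moreover have "inj (\<lambda>j. d (2 * j + 1))" by (rule injI) (simp add: d_eq)
    ultimately show False using finite_subset range_inj_infinite by blast
  qed
  ultimately show ?thesis by (rule that)
qed

lemma funpow_gen: "g \<in> gen K \<Longrightarrow> g ^^ i \<in> gen K"
proof (induction i)
  case 0
  show ?case by (simp only: funpow.simps gen_id)
next
  case (Suc i)
  then show ?case unfolding funpow.simps by (intro gen_comp)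
qed

text \<open>Row \<open>i \<ge> 0\<close> of \<open>F\<close> acts as \<open>f i\<close> at all heights \<open>k \<ge> 0\<close>. Lifting a single row by one and
  comparing with \<open>F\<close> isolates \<open>f i\<close> at one place.\<close>

lemma sequence_at_origin:
  fixes f :: "nat \<Rightarrow> 'a \<Rightarrow> 'a"
  assumes f: "\<And>i. bij (f i)"
  shows "\<exists>K. finite K \<and> K \<subseteq> Sym \<and> (\<forall>i. transport (\<lambda>a. (a, 0 :: int, 0 :: int)) (f i) \<in> gen K)"
proof -
  define F where "F = (\<lambda>(a, i :: int, k :: int). (if 0 \<le> i \<and> 0 \<le> k then f (nat i) a else a, i, k))"
  define F' where "F' = (\<lambda>(a, i :: int, k :: int). (if 0 \<le> i \<and> 0 \<le> k then inv (f (nat i)) a else a, i, k))"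
  define t where "t = (\<lambda>(a :: 'a, i :: int, k :: int). (a, i, if i = 0 then k + 1 else k))"
  define t' where "t' = (\<lambda>(a :: 'a, i :: int, k :: int). (a, i, if i = 0 then k - 1 else k))"
  define s where "s = (\<lambda>(a :: 'a, i :: int, k :: int). (a, i + 1, k))"
  define s' where "s' = (\<lambda>(a :: 'a, i :: int, k :: int). (a, i - 1, k))"
  have f_inv: "f i (inv (f i) a) = a" "inv (f i) (f i a) = a" for i a
    using f by (simp_all add: bij_is_surj surj_f_inv_f bij_is_inj)
  have "bij F" by (rule o_bij[of F']) (auto simp: F_def F'_def f_inv fun_eq_iff)
  moreover have "bij F'" by (rule o_bij[of F]) (auto simp: F_def F'_def f_inv fun_eq_iff)
  moreover have "bij t" by (rule o_bij[of t']) (auto simp: t_def t'_def fun_eq_iff)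
  moreover have "bij t'" by (rule o_bij[of t]) (auto simp: t_def t'_def fun_eq_iff)
  moreover have "bij s" by (rule o_bij[of s']) (auto simp: s_def s'_def fun_eq_iff)
  moreover have "bij s'" by (rule o_bij[of s]) (auto simp: s_def s'_def fun_eq_iff)
  ultimately have K: "{F, F', t, t', s, s'} \<subseteq> Sym" by (simp add: Sym_def)
  have s_pow: "(s ^^ n) (a, i, k) = (a, i + int n, k)" for n a i k
    by (induction n) (auto simp: s_def)
  have s'_pow: "(s' ^^ n) (a, i, k) = (a, i - int n, k)" for n a i k
    by (induction n) (auto simp: s'_def)
  \<comment> \<open>Conjugation by \<open>s ^^ n\<close> brings row \<open>n\<close> to row 0. The
    inverse of the conjugated \<open>F\<close> is then conjugated by \<open>t\<close>, which lifts
    row 0 only: all other rows cancel, and in row 0 only height 0 survives.\<close>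
  have "transport (\<lambda>a. (a, 0, 0)) (f n)
    = (s' ^^ n \<circ> F \<circ> s ^^ n) \<circ> t \<circ> (s' ^^ n \<circ> F' \<circ> s ^^ n) \<circ> t'" for n
    by (rule transport_eqI)
      (auto simp: inj_def F_def F'_def t_def t'_def s_pow s'_pow f_inv)
  moreover have "g \<in> gen {F, F', t, t', s, s'}" if "g \<in> {F, F', t, t', s, s'}" for g
    using that by (rule gen_gen)
  ultimately have "transport (\<lambda>a. (a, 0, 0)) (f n) \<in> gen {F, F', t, t', s, s'}" for n
    by (simp only:) (intro gen_comp funpow_gen, simp_all)
  then show ?thesis using K by (intro exI[of _ "{F, F', t, t', s, s'}"]) simp
qed

section \<open>Permutations with restricted support\<close>

definition Sym_on :: "'a set \<Rightarrow> ('a \<Rightarrow> 'a) set" where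
  "Sym_on M = {g \<in> Sym. \<forall>x. x \<notin> M \<longrightarrow> g x = x}"

lemma inv_Sym_on:
  assumes "g \<in> Sym_on M" shows "inv g \<in> Sym_on M"
proof -
  have g: "bij g" "\<And>x. x \<notin> M \<Longrightarrow> g x = x" using assms by (auto simp: Sym_on_def Sym_def)
  have "inv g x = x" if "x \<notin> M" for x using g(2)[OF that] g(1) by (metis bij_inv_eq_iff)
  then show ?thesis using g(1) by (simp add: Sym_on_def Sym_def bij_imp_bij_inv)
qed

text \<open>A bijection \<open>r\<close> from \<Omega> onto \<open>M\<close> turns the members of
  \<open>C\<close> into a sequence of permutations of \<Omega>, which
  \<open>sequence_at_origin\<close> realises on one copy of \<Omega> in a grid. The grid embeds
  co-infinitely into \<Omega>, and since \<open>- M\<close> is infinite, a permutation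
  \<open>v\<close> carries that copy onto \<open>M\<close>.\<close>

lemma countable_Sym_on_finitely_generated:
  fixes M :: "'a set"
  assumes cnt: "countable (UNIV :: 'a set)" and inf: "infinite M" "infinite (- M)"
    and C: "countable C" "C \<subseteq> Sym_on M"
  shows "\<exists>U. finite U \<and> U \<subseteq> Sym \<and> C \<subseteq> gen U"
proof (cases "C = {}")
  case False
  have inf_U: "infinite (UNIV :: 'a set)" using infinite_super[OF subset_UNIV inf(1)] .
  obtain r :: "'a \<Rightarrow> 'a" where r: "bij_betw r UNIV M"
    using bij_betw_trans[OF to_nat_on_infinite[OF cnt inf_U]
        bij_betw_from_nat_into[OF countable_subset[OF subset_UNIV cnt] inf(1)]] by blast
  then have r_inj: "inj r" and r_range: "range r = M" by (auto simp: bij_betw_def)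
  \<comment> \<open>The enumeration may repeat values, so finite non-empty \<open>C\<close> is
    covered too.\<close>
  define h where "h i = from_nat_into C i" for i
  have h_range: "range h = C" using range_from_nat_into[OF False C(1)] by (simp add: h_def[abs_def])
  have h: "bij (h i)" "\<And>x. x \<notin> M \<Longrightarrow> h i x = x" for i
    using h_range C(2) by (auto simp: Sym_on_def Sym_def)
  have h_M: "bij_betw (h i) M M" for i
  proof -
    have "h i ` (- M) = - M" using h(2) by force
    then have "h i ` M = M" using bij_image_Compl_eq[OF h(1), of i M] by blast
    then show ?thesis using h(1) by (metis bij_betw_def inj_on_subset subset_UNIV)
  qed
  define f where "f i = inv r \<circ> (h i \<circ> r)" for i
  have f_bij: "bij (f i)" for i
    unfolding f_def
    by (rule bij_betw_trans[OF bij_betw_trans[OF r h_M] bij_betw_inv_into[OF r]])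
  have h_eq: "transport r (f i) = h i" for i
  proof (rule transport_eqI[OF r_inj])
    show "h i (r x) = r (f i x)" for x
      using bij_betwE[OF h_M] bij_betwE[OF r] r_range by (simp add: f_def f_inv_into_f)
    show "h i y = y" if "y \<notin> range r" for y using h(2) that r_range by blast
  qed
  obtain K where K: "finite K" "K \<subseteq> Sym"
      "\<And>i. transport (\<lambda>a. (a, 0 :: int, 0 :: int)) (f i) \<in> gen K"
    using sequence_at_origin[of f] f_bij by blast
  have "countable (UNIV :: ('a \<times> int \<times> int) set)"
    using countable_SIGMA[OF cnt, of "\<lambda>_. UNIV :: (int \<times> int) set"] by simp
  then obtain p :: "'a \<times> int \<times> int \<Rightarrow> 'a" where p: "inj p" "infinite (- range p)"
    using ex_inj_coinfinite[OF _ cnt inf_U] by metis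
  define r0 where "r0 = p \<circ> (\<lambda>a. (a, 0, 0))"
  have r0: "inj r0" unfolding r0_def using p(1) by (intro inj_compose) (auto simp: inj_def)
  have "- range p \<subseteq> - range r0" by (auto simp: r0_def)
  then have "infinite (- range r0)" using p(2) finite_subset by blast
  then obtain v where v: "bij v" "v \<circ> r0 = r"
    using conjugator[OF cnt r0 r_inj] inf(2) r_range by metis
  let ?U = "insert v (transport p ` K)"
  have "h i \<in> gen ?U" for i
  proof -
    have "h i = v \<circ> transport r0 (f i) \<circ> inv v"
      using transport_conj[OF r0 v(1)] v(2) h_eq by simp
    moreover have "transport r0 (f i) = transport p (transport (\<lambda>a. (a, 0, 0)) (f i))"
      unfolding r0_def by (rule transport_transport[symmetric]) (use p(1) in \<open>auto simp: inj_def\<close>)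
    moreover have "\<dots> \<in> gen ?U"
      using transport_gen[OF p(1) K(2,3)] gen_mono[of "transport p ` K" ?U] by blast
    moreover have "v \<in> gen ?U" by (simp add: gen_gen)
    ultimately show ?thesis by (simp only:) (intro gen_comp gen_inv)
  qed
  moreover have "?U \<subseteq> Sym" using v(1) transport_bij(1)[OF p(1)] K(2) by (auto simp: Sym_def)
  ultimately show ?thesis using K(1) h_range by (intro exI[of _ ?U]) auto
qed (auto intro!: exI[of _ "{}"])

text \<open>First \<open>h\<close> pushes the part of \<open>f\<close>
  A\<open>outside\<close>A\<open>into\<close>B\<open>, leaving infinitely many points of\<close>B\<open>free. Then\<close>k\<open>can bring every point of\<close>A\<open>back to its place within\<close>A
  \<union>
  B\<open>. The result\<close>l\<open>fixes\<close>A\<open>pointwise, and\<close>f\<open>is recovered by inverting\<close>h\<open>and\<close>k\<open>. The infinite set of points of\<close>B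
  \<union> C\<open>outside\<close>f \<open>A\<close> is the room that \<open>h\<close>
  requires.\<close>

lemma Sym_factorization_aux:
  fixes A B C :: "'a set"
  assumes cnt: "countable (UNIV :: 'a set)"
    and part: "A \<union> B \<union> C = UNIV" "A \<inter> B = {}" "A \<inter> C = {}" "B \<inter> C = {}"
    and inf: "infinite A" "infinite B" "infinite C"
    and f: "bij f" "infinite ((B \<union> C) - f ` A)"
  shows "\<exists>h\<in>Sym_on (B \<union> C). \<exists>k\<in>Sym_on (A \<union> B). \<exists>l\<in>Sym_on (B \<union> C). f = h \<circ> k \<circ> l"
proof -
  have cntX: "countable X" for X :: "'a set" using countable_subset[OF subset_UNIV cnt] .
  obtain b :: "nat \<Rightarrow> 'a" where b: "bij_betw b UNIV B"
    using bij_betw_from_nat_into[OF cntX inf(2)] by blast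
  have b_eq: "b i = b j \<longleftrightarrow> i = j" for i j using b by (simp add: bij_betw_def inj_eq)
  have bB: "b i \<in> B" for i using b bij_betwE by blast
  \<comment> \<open>An injection of all of \<Omega> into the even half of \<open>B\<close>; the odd
    half is the room kept free.\<close>
  define \<psi> where "\<psi> x = b (2 * to_nat_on UNIV x)" for x :: 'a
  have \<psi>_inj: "inj \<psi>"
    using inj_on_to_nat_on[OF cnt] by (auto simp: \<psi>_def inj_def b_eq)
  have \<psi>_coinf: "infinite (B - range \<psi>)"
  proof
    assume "finite (B - range \<psi>)"
    moreover have "range (\<lambda>j. b (2 * j + 1)) \<subseteq> B - range \<psi>"
    proof clarify
      fix i show "b (2 * i + 1) \<in> B - range \<psi>"
        using bB by (auto simp: \<psi>_def b_eq) presburger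
    qed
    moreover have "inj (\<lambda>j. b (2 * j + 1))" by (rule injI) (simp add: b_eq)
    ultimately show False using finite_subset range_inj_infinite by blast
  qed
  let ?P = "f ` A \<inter> (B \<union> C)"
  have \<psi>B: "\<psi> x \<in> B" for x by (simp add: \<psi>_def bB)
  have inf1: "infinite (B \<union> C - ?P)"
    using f(2) by (simp add: Diff_Int_distrib2 Diff_Int)
  have inf2: "infinite (B - \<psi> ` ?P)"
  proof
    assume "finite (B - \<psi> ` ?P)"
    moreover have "B - range \<psi> \<subseteq> B - \<psi> ` ?P" by auto
    ultimately show False using \<psi>_coinf finite_subset by blast
  qed
  have inf2': "infinite (B \<union> C - \<psi> ` ?P)"
  proof
    assume "finite (B \<union> C - \<psi> ` ?P)"
    moreover have "B - \<psi> ` ?P \<subseteq> B \<union> C - \<psi> ` ?P" by auto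
    ultimately show False using inf2 finite_subset by blast
  qed
  have "bij_betw \<psi> ?P (\<psi> ` ?P)" using \<psi>_inj by (meson inj_on_imp_bij_betw inj_on_subset subset_UNIV)
  then obtain h where h: "bij h" "\<And>x. x \<in> ?P \<Longrightarrow> h x = \<psi> x" "\<And>x. x \<notin> B \<union> C \<Longrightarrow> h x = x"
    using extend_bij_betw[OF cnt, of \<psi> ?P "\<psi> ` ?P" "B \<union> C"] inf1 inf2' \<psi>B by blast
  let ?g = "h \<circ> f"
  have g_bij: "bij ?g" using h(1) f(1) by (simp add: bij_comp)
  have gA: "?g x \<in> A \<or> ?g x \<in> \<psi> ` ?P" if "x \<in> A" for x
  proof (cases "f x \<in> B \<union> C")
    case True
    then show ?thesis using h(2)[of "f x"] that by simp
  next
    case False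
    then show ?thesis using h(3)[of "f x"] part(1) by auto
  qed
  have gA_sub: "?g ` A \<subseteq> A \<union> B"
  proof (rule image_subsetI)
    show "?g x \<in> A \<union> B" if "x \<in> A" for x using gA[OF that] \<psi>B by (elim disjE imageE) simp_all
  qed
  have "infinite (A \<union> B - ?g ` A)"
  proof
    assume "finite (A \<union> B - ?g ` A)"
    moreover have "B - \<psi> ` ?P \<subseteq> A \<union> B - ?g ` A"
    proof
      fix y assume y: "y \<in> B - \<psi> ` ?P"
      have "y \<noteq> ?g x" if "x \<in> A" for x
      proof
        assume "y = ?g x"
        then have "y \<in> A \<or> y \<in> \<psi> ` ?P" using gA[OF that] by (simp only:)
        then show False using y part(2) by blast
      qed
      then have "y \<notin> ?g ` A" by (metis imageE)
      then show "y \<in> A \<union> B - ?g ` A" using y by blast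
    qed
    ultimately show False using inf2 finite_subset by blast
  qed
  moreover have "infinite (A \<union> B - A)" using inf(2) part(2) by (simp add: Diff_triv Un_Diff inf_commute)
  moreover have "bij_betw (inv ?g) (?g ` A) A"
    using g_bij by (metis bij_betw_def bij_betw_subset bij_imp_bij_inv bij_is_inj image_inv_f_f subset_UNIV)
  ultimately obtain k where k: "bij k" "\<And>x. x \<in> ?g ` A \<Longrightarrow> k x = inv ?g x" "\<And>x. x \<notin> A \<union> B \<Longrightarrow> k x = x"
    using extend_bij_betw[OF cnt, of "inv ?g" "?g ` A" A "A \<union> B"] gA_sub by blast
  define l where "l = k \<circ> ?g"
  have "l x = x" if "x \<in> A" for x
    using k(2)[of "?g x"] that g_bij by (simp add: l_def bij_is_inj del: o_apply) (simp add: bij_is_inj inv_f_f)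
  moreover have "bij l" unfolding l_def using k(1) g_bij by (rule bij_comp[rotated])
  ultimately have "l \<in> Sym_on (B \<union> C)" using part(1) by (auto simp: Sym_on_def Sym_def)
  moreover have "h \<in> Sym_on (B \<union> C)" using h(1,3) by (simp add: Sym_on_def Sym_def)
  then have "inv h \<in> Sym_on (B \<union> C)" by (rule inv_Sym_on)
  moreover have "k \<in> Sym_on (A \<union> B)" using k(1,3) by (simp add: Sym_on_def Sym_def)
  then have "inv k \<in> Sym_on (A \<union> B)" by (rule inv_Sym_on)
  moreover have "f = inv h \<circ> inv k \<circ> l"
  proof
    fix x
    have "inv k (l x) = h (f x)" using k(1) by (simp add: l_def bij_is_inj)
    then show "f x = (inv h \<circ> inv k \<circ> l) x" using h(1) by (simp add: bij_is_inj)
  qed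
  ultimately show ?thesis by (intro bexI)
qed

lemma Sym_factorization:
  fixes A B C :: "'a set"
  assumes cnt: "countable (UNIV :: 'a set)"
    and part: "A \<union> B \<union> C = UNIV" "A \<inter> B = {}" "A \<inter> C = {}" "B \<inter> C = {}"
    and inf: "infinite A" "infinite B" "infinite C"
    and f: "bij f"
  shows "\<exists>k0\<in>Sym_on (A \<union> B). \<exists>h\<in>Sym_on (B \<union> C). \<exists>k\<in>Sym_on (A \<union> B). \<exists>l\<in>Sym_on (B \<union> C).
    f = k0 \<circ> h \<circ> k \<circ> l"
proof (cases "infinite ((B \<union> C) - f ` A)")
  case True
  have "id \<in> Sym_on (A \<union> B)" by (simp add: Sym_on_def Sym_def)
  then show ?thesis using Sym_factorization_aux[OF assms True] by (metis id_comp)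
next
  case False
  have cntX: "countable X" for X :: "'a set" using countable_subset[OF subset_UNIV cnt] .
  have "infinite (A - f ` A)"
  proof
    assume "finite (A - f ` A)"
    then have "finite ((A - f ` A) \<union> ((B \<union> C) - f ` A))" using False by simp
    moreover have "(A - f ` A) \<union> ((B \<union> C) - f ` A) = f ` (- A)"
      using part(1) bij_image_Compl_eq[OF f, of A] by blast
    ultimately have "finite (- A)" using f by (metis bij_is_inj finite_imageD inj_on_subset subset_UNIV)
    moreover have "B \<subseteq> - A" using part(2) by blast
    ultimately show False using inf(2) finite_subset by blast
  qed
  obtain \<phi> where \<phi>: "bij_betw \<phi> A B"
    using bij_betw_trans[OF to_nat_on_infinite[OF cntX inf(1)] bij_betw_from_nat_into[OF cntX inf(2)]]
    by blast
  have "A \<union> B - A = B" "A \<union> B - B = A" using part(2) by auto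
  then obtain v where v: "bij v" "\<And>x. x \<in> A \<Longrightarrow> v x = \<phi> x" "\<And>x. x \<notin> A \<union> B \<Longrightarrow> v x = x"
    using extend_bij_betw[OF cnt \<phi>, of "A \<union> B"] inf by auto
  have "infinite ((B \<union> C) - (v \<circ> f) ` A)"
  proof
    assume "finite ((B \<union> C) - (v \<circ> f) ` A)"
    moreover have "v ` (A - f ` A) \<subseteq> (B \<union> C) - (v \<circ> f) ` A"
    proof clarify
      fix x assume x: "x \<in> A" "x \<notin> f ` A"
      then have "v x \<in> B" using v(2) bij_betwE[OF \<phi>] by simp
      moreover have "v x \<notin> (v \<circ> f) ` A" using x(2) v(1) by (auto simp: bij_is_inj inj_eq)
      ultimately show "v x \<in> (B \<union> C) - (v \<circ> f) ` A" by blast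
    qed
    ultimately have "finite (v ` (A - f ` A))" using finite_subset by blast
    then have "finite (A - f ` A)" using v(1) by (metis bij_is_inj finite_imageD inj_on_subset subset_UNIV)
    then show False using \<open>infinite (A - f ` A)\<close> by simp
  qed
  moreover have "bij (v \<circ> f)" using v(1) f by (simp add: bij_comp)
  ultimately obtain h k l where hkl: "h \<in> Sym_on (B \<union> C)" "k \<in> Sym_on (A \<union> B)" "l \<in> Sym_on (B \<union> C)"
      "v \<circ> f = h \<circ> k \<circ> l"
    using Sym_factorization_aux[OF cnt part inf] by metis
  have "v \<in> Sym_on (A \<union> B)" using v by (auto simp: Sym_on_def Sym_def)
  then have "inv v \<in> Sym_on (A \<union> B)" by (rule inv_Sym_on)
  moreover have "f = inv v \<circ> h \<circ> k \<circ> l"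
  proof -
    have "f = inv v \<circ> (v \<circ> f)" using v(1) by (simp add: fun_eq_iff bij_is_inj)
    then show ?thesis unfolding hkl(4) by (simp add: comp_assoc)
  qed
  ultimately show ?thesis using hkl by blast
qed

text \<open>\<Omega> is cut into three infinite parts. By the factorization every element of
  \<open>C\<close> is a product of four permutations, each supported in one of two sets with
  infinite complement, so two applications of \<open>countable_Sym_on_finitely_generated\<close>
  cover all factors.\<close>

lemma countable_finitely_generated:
  fixes C :: "('a \<Rightarrow> 'a) set"
  assumes cnt: "countable (UNIV :: 'a set)" "infinite (UNIV :: 'a set)"
    and C: "countable C" "C \<subseteq> Sym"
  shows "\<exists>U. finite U \<and> U \<subseteq> Sym \<and> C \<subseteq> gen U"
proof -
  obtain d :: "nat \<Rightarrow> 'a" where d: "bij d" using bij_betw_from_nat_into[OF cnt] by blast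
  define R where "R i = d ` {n. n mod 3 = i}" for i :: nat
  have R_inf: "infinite (R i)" if "i < 3" for i
  proof
    assume "finite (R i)"
    then have "finite {n. n mod 3 = i}" unfolding R_def
      using d by (metis bij_is_inj finite_imageD inj_on_subset subset_UNIV)
    moreover have "range (\<lambda>n. 3 * n + i) \<subseteq> {n. n mod 3 = i}" using that by auto
    moreover have "inj (\<lambda>n. 3 * n + i)" by (simp add: inj_def)
    ultimately show False using finite_subset range_inj_infinite by blast
  qed
  have R_disj: "R i \<inter> R j = {}" if "i \<noteq> j" for i j
    using that d by (auto simp: R_def bij_is_inj inj_eq)
  have R_Un: "R 0 \<union> R 1 \<union> R 2 = UNIV"
  proof -
    have "R 0 \<union> R 1 \<union> R 2 = d ` ({n. n mod 3 = 0} \<union> {n. n mod 3 = 1} \<union> {n. n mod 3 = 2})"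
      by (simp only: R_def image_Un)
    also have "{n :: nat. n mod 3 = 0} \<union> {n. n mod 3 = 1} \<union> {n. n mod 3 = 2} = UNIV"
      by auto
    finally show ?thesis using d by (simp add: bij_is_surj)
  qed
  let ?X = "R 0 \<union> R 1" and ?Y = "R 1 \<union> R 2"
  \<comment> \<open>The four factors are packed into one tuple, so that a single choice function
    supplies them for all \<open>f\<close>.\<close>
  define P where "P f t \<longleftrightarrow> fst t \<in> Sym_on ?X \<and> fst (snd t) \<in> Sym_on ?Y \<and>
      fst (snd (snd t)) \<in> Sym_on ?X \<and> snd (snd (snd t)) \<in> Sym_on ?Y \<and>
      fst t \<circ> fst (snd t) \<circ> fst (snd (snd t)) \<circ> snd (snd (snd t)) = f" for f t
  have "\<forall>f\<in>C. \<exists>t. P f t"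
  proof
    fix f assume "f \<in> C"
    then have "bij f" using C(2) by (auto simp: Sym_def)
    have "\<exists>k0\<in>Sym_on ?X. \<exists>h\<in>Sym_on ?Y. \<exists>k\<in>Sym_on ?X. \<exists>l\<in>Sym_on ?Y. f = k0 \<circ> h \<circ> k \<circ> l"
      by (rule Sym_factorization[OF cnt(1) R_Un _ _ _ _ _ _ \<open>bij f\<close>]; intro R_disj R_inf; simp)
    then obtain k0 h k l where "k0 \<in> Sym_on ?X" "h \<in> Sym_on ?Y"
        "k \<in> Sym_on ?X" "l \<in> Sym_on ?Y" "f = k0 \<circ> h \<circ> k \<circ> l"
      by (elim bexE)
    then have "P f (k0, h, k, l)" unfolding P_def by simp
    then show "\<exists>t. P f t" ..
  qed
  from bchoice[OF this] obtain t where t: "\<forall>f\<in>C. P f (t f)" ..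
  define a b c e where "a f = fst (t f)" and "b f = fst (snd (t f))"
    and "c f = fst (snd (snd (t f)))" and "e f = snd (snd (snd (t f)))" for f
  have F: "\<And>f. f \<in> C \<Longrightarrow> a f \<in> Sym_on ?X" "\<And>f. f \<in> C \<Longrightarrow> b f \<in> Sym_on ?Y"
      "\<And>f. f \<in> C \<Longrightarrow> c f \<in> Sym_on ?X" "\<And>f. f \<in> C \<Longrightarrow> e f \<in> Sym_on ?Y"
      "\<And>f. f \<in> C \<Longrightarrow> a f \<circ> b f \<circ> c f \<circ> e f = f"
    using t by (simp_all only: P_def a_def b_def c_def e_def)
  have sub: "R 2 \<subseteq> - ?X" "R 0 \<subseteq> - ?Y" using R_disj[of 0 2] R_disj[of 1 2] R_disj[of 0 1] by auto
  have co: "infinite (- ?X)" "infinite (- ?Y)"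
    using infinite_super[OF sub(1) R_inf] infinite_super[OF sub(2) R_inf] by simp_all
  have in_on: "countable (a ` C \<union> c ` C)" "a ` C \<union> c ` C \<subseteq> Sym_on ?X"
    "countable (b ` C \<union> e ` C)" "b ` C \<union> e ` C \<subseteq> Sym_on ?Y"
    using C(1) F(1-4) by auto
  have inf: "infinite ?X" "infinite ?Y" using R_inf[of 1] by simp_all
  obtain U where U: "finite U" "U \<subseteq> Sym" "a ` C \<union> c ` C \<subseteq> gen U"
    using countable_Sym_on_finitely_generated[OF cnt(1) inf(1) co(1) in_on(1,2)] by (elim exE conjE)
  obtain V where V: "finite V" "V \<subseteq> Sym" "b ` C \<union> e ` C \<subseteq> gen V"
    using countable_Sym_on_finitely_generated[OF cnt(1) inf(2) co(2) in_on(3,4)] by (elim exE conjE)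
  have "f \<in> gen (U \<union> V)" if "f \<in> C" for f
  proof -
    have "a f \<in> gen (U \<union> V)" "c f \<in> gen (U \<union> V)"
      using U(3) gen_mono[of U "U \<union> V"] that by blast+
    moreover have "b f \<in> gen (U \<union> V)" "e f \<in> gen (U \<union> V)"
      using V(3) gen_mono[of V "U \<union> V"] that by blast+
    ultimately have "a f \<circ> b f \<circ> c f \<circ> e f \<in> gen (U \<union> V)" by (intro gen_comp)
    then show ?thesis by (simp only: F(5)[OF that])
  qed
  then show ?thesis using U(1,2) V(1,2) by (intro exI[of _ "U \<union> V"]) auto
qed

subsection \<open>Closed subgroups and Baire category\<close>

lemma orbit_eq_image: "orbit H x = (\<lambda>h. h x) ` H"
  by (auto simp: orbit_def)

lemma subgroupD:
  assumes "is_subgroup G"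
  shows "G \<subseteq> Sym" "id \<in> G" "g \<in> G \<Longrightarrow> h \<in> G \<Longrightarrow> g \<circ> h \<in> G" "g \<in> G \<Longrightarrow> inv g \<in> G"
    and "g \<in> G \<Longrightarrow> bij g"
  using assms by (auto simp: is_subgroup_def Sym_def)

lemma subgroup_inv_apply:
  assumes "is_subgroup G" "g \<in> G"
  shows "inv g (g x) = x" "g (inv g x) = x"
  using subgroupD(5)[OF assms] by (simp_all add: bij_is_inj bij_is_surj surj_f_inv_f)

lemma is_subgroup_pstab:
  assumes "is_subgroup G" shows "is_subgroup (pstab G \<Gamma>)"
proof -
  have "inv g x = x" if "g \<in> G" "g x = x" for g x
    using subgroup_inv_apply(1)[OF assms that(1), of x] that(2) by simp
  then show ?thesis
    unfolding is_subgroup_def pstab_def using subgroupD[OF assms] by auto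
qed

lemma closed_in_Sym_pstab:
  assumes "closed_in_Sym G" shows "closed_in_Sym (pstab G \<Gamma>)"
  unfolding closed_in_Sym_def
proof (intro ballI impI)
  fix f assume f: "f \<in> Sym" "\<forall>F. finite F \<longrightarrow> (\<exists>g\<in>pstab G \<Gamma>. \<forall>x\<in>F. g x = f x)"
  have "\<exists>g\<in>G. \<forall>x\<in>F. g x = f x" if "finite F" for F
    using f(2) that unfolding pstab_def by blast
  then have "f \<in> G" using assms f(1) unfolding closed_in_Sym_def by blast
  moreover have "f x = x" if "x \<in> \<Gamma>" for x
    using f(2)[rule_format, of "{x}"] that by (auto simp: pstab_def)
  ultimately show "f \<in> pstab G \<Gamma>" by (simp add: pstab_def)
qed

lemma is_subgroup_S_part: "is_subgroup (S_part A)"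
proof -
  have "inv f \<in> S_part A" if f: "f \<in> S_part A" for f
  proof -
    have "bij f" using f by (simp add: S_part_def Sym_def)
    moreover have "inv f ` \<Sigma> = \<Sigma>" if "\<Sigma> \<in> A" for \<Sigma>
      using f that image_inv_f_f[OF bij_is_inj[OF \<open>bij f\<close>], of \<Sigma>] by (simp add: S_part_def)
    ultimately show ?thesis by (simp add: S_part_def Sym_def bij_imp_bij_inv)
  qed
  moreover have "id \<in> S_part A" by (simp add: S_part_def Sym_def)
  moreover have "S_part A \<subseteq> Sym" by (auto simp: S_part_def)
  ultimately show ?thesis unfolding is_subgroup_def using S_part_comp by blast
qed

lemma closed_in_Sym_S_part:
  assumes "\<And>\<Sigma>. \<Sigma> \<in> B \<Longrightarrow> finite \<Sigma>" shows "closed_in_Sym (S_part B)"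
  unfolding closed_in_Sym_def
proof (intro ballI impI)
  fix f assume f: "f \<in> Sym" "\<forall>F. finite F \<longrightarrow> (\<exists>g\<in>S_part B. \<forall>x\<in>F. g x = f x)"
  have "f ` \<Sigma> = \<Sigma>" if \<Sigma>: "\<Sigma> \<in> B" for \<Sigma>
  proof -
    obtain g where g: "g \<in> S_part B" "\<forall>x\<in>\<Sigma>. g x = f x" using f(2) assms[OF \<Sigma>] by blast
    have "g ` \<Sigma> = \<Sigma>" using g(1) \<Sigma> by (simp add: S_part_def)
    moreover have "g ` \<Sigma> = f ` \<Sigma>" using g(2) by (intro image_cong) auto
    ultimately show ?thesis by simp
  qed
  then show "f \<in> S_part B" using f(1) by (simp add: S_part_def)
qed

text \<open>A pointwise limit of permutations is injective but may fail to be surjective;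
  \<open>ran\<close> excludes this by freezing a preimage of every point. \<open>dom\<close> makes
  the limit total, and closedness then puts it into \<open>G\<close>.\<close>

lemma closed_limit:
  assumes G: "closed_in_Sym G" "G \<subseteq> Sym" and g: "\<And>i. g i \<in> G"
    and mono: "\<And>i. \<Gamma> i \<subseteq> \<Gamma> (Suc i)" and agree: "\<And>i x. x \<in> \<Gamma> i \<Longrightarrow> g (Suc i) x = g i x"
    and dom: "\<And>x. \<exists>i. x \<in> \<Gamma> i" and ran: "\<And>y. \<exists>i. y \<in> g i ` \<Gamma> i"
  shows "\<exists>h\<in>G. \<forall>i. \<forall>x\<in>\<Gamma> i. h x = g i x"
proof -
  have mono': "\<Gamma> i \<subseteq> \<Gamma> j" if "i \<le> j" for i j
    by (rule lift_Suc_mono_le[of \<Gamma>, OF mono that])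
  have agree': "g j x = g i x" if "i \<le> j" "x \<in> \<Gamma> i" for i j x
    using that(1)
  proof (induction rule: dec_induct)
    case (step n)
    have "x \<in> \<Gamma> n" using mono'[OF step.hyps(1)] that(2) by blast
    then show ?case using step.IH agree by simp
  qed simp
  define h where "h x = g (LEAST i. x \<in> \<Gamma> i) x" for x
  have h: "h x = g i x" if "x \<in> \<Gamma> i" for x i
  proof -
    have "x \<in> \<Gamma> (LEAST i. x \<in> \<Gamma> i)" "(LEAST i. x \<in> \<Gamma> i) \<le> i"
      using that by (auto intro: LeastI Least_le)
    then show ?thesis unfolding h_def using agree'[of "LEAST i. x \<in> \<Gamma> i" i x] by simp
  qed
  have g_inj: "inj (g i)" for i using g[of i] G(2) by (auto simp: Sym_def bij_is_inj)
  have "inj h"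
  proof (rule injI)
    fix x y assume xy: "h x = h y"
    obtain i j where "x \<in> \<Gamma> i" "y \<in> \<Gamma> j" using dom by blast
    then have "x \<in> \<Gamma> (max i j)" "y \<in> \<Gamma> (max i j)"
      using mono'[of i "max i j"] mono'[of j "max i j"] by auto
    then have "g (max i j) x = g (max i j) y" using h xy by metis
    then show "x = y" using g_inj by (simp add: inj_eq)
  qed
  moreover have "surj h"
    unfolding surj_def
  proof
    fix y obtain i x where "x \<in> \<Gamma> i" "y = g i x" using ran by blast
    then show "\<exists>x. y = h x" using h by metis
  qed
  ultimately have h_Sym: "h \<in> Sym" by (simp add: Sym_def bij_def)
  have "\<exists>k\<in>G. \<forall>x\<in>F. k x = h x" if "finite F" for F
  proof -
    have "\<exists>N. F \<subseteq> \<Gamma> N" using that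
    proof (induction F rule: finite_induct)
      case (insert a F)
      then obtain N where N: "F \<subseteq> \<Gamma> N" by blast
      obtain M where M: "a \<in> \<Gamma> M" using dom by blast
      have "insert a F \<subseteq> \<Gamma> (max M N)"
        using N M mono'[of M "max M N"] mono'[of N "max M N"] by auto
      then show ?case by blast
    qed simp
    then obtain N where "F \<subseteq> \<Gamma> N" by blast
    then have "\<forall>x\<in>F. g N x = h x" using h by auto
    then show ?thesis using g by blast
  qed
  then have "h \<in> G" using G(1) h_Sym unfolding closed_in_Sym_def by blast
  then show ?thesis using h by blast
qed

text \<open>A Baire category argument: if every coset of every basic open subgroup escaped every \<open>W k\<close>,
  some limit of such cosets would escape all of them.\<close>

lemma closed_subgroup_cover:
  fixes G :: "('a \<Rightarrow> 'a) set"
  assumes cnt: "countable (UNIV :: 'a set)" and G: "is_subgroup G" "closed_in_Sym G"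
    and cover: "G \<subseteq> (\<Union>k :: nat. W k)"
  shows "\<exists>k \<Gamma> g. finite \<Gamma> \<and> g \<in> G \<and> (\<forall>h\<in>pstab G \<Gamma>. \<forall>x. g (h x) \<in> orbit (W k) x)"
proof (rule ccontr)
  assume "\<not> ?thesis"
  \<comment> \<open>Escape is witnessed at a single point \<open>x\<close>, so freezing one value of
    the approximation keeps the limit outside \<open>W k\<close>.\<close>
  then have escape: "\<exists>h\<in>pstab G \<Gamma>. \<exists>x. g (h x) \<notin> orbit (W k) x" if "finite \<Gamma>" "g \<in> G" for k \<Gamma> g
    using that by blast
  define d :: "nat \<Rightarrow> 'a" where "d = from_nat_into UNIV"
  have d: "surj d" unfolding d_def using range_from_nat_into[OF UNIV_not_empty cnt] .
  define P :: "nat \<Rightarrow> ('a \<Rightarrow> 'a) \<times> 'a set \<Rightarrow> bool" where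
    "P n s \<longleftrightarrow> fst s \<in> G \<and> finite (snd s)" for n s
  \<comment> \<open>Stage \<open>n\<close> freezes a value that avoids \<open>W n\<close>; it also
    puts \<open>d n\<close> into the domain and the image, so that the limit becomes a
    permutation.\<close>
  define Q where "Q n s s' \<longleftrightarrow> snd s \<subseteq> snd s' \<and> (\<forall>x\<in>snd s. fst s' x = fst s x) \<and> d n \<in> snd s' \<and>
    d n \<in> fst s' ` snd s' \<and> (\<exists>x\<in>snd s'. fst s' x \<notin> orbit (W n) x)"
    for n :: nat and s s' :: "('a \<Rightarrow> 'a) \<times> 'a set"
  have "\<exists>s. \<forall>n. P n (s n) \<and> Q n (s n) (s (Suc n))"
  proof (rule dependent_nat_choice)
    show "\<exists>s. P 0 s" using subgroupD(2)[OF G(1)] by (intro exI[of _ "(id, {})"]) (simp add: P_def)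
    fix s n assume "P n s"
    then have s: "fst s \<in> G" "finite (snd s)" by (auto simp: P_def)
    from escape[OF s(2,1)] obtain h x where hx: "h \<in> pstab G (snd s)" "fst s (h x) \<notin> orbit (W n) x"
      by blast
    let ?g = "fst s \<circ> h"
    have gG: "?g \<in> G" using hx(1) s(1) subgroupD(3)[OF G(1)] by (auto simp: pstab_def)
    \<comment> \<open>Freezing \<open>inv ?g (d n)\<close> is what puts \<open>d n\<close> into the
      image.\<close>
    let ?s' = "(?g, snd s \<union> {x, d n, inv ?g (d n)})"
    have "P (Suc n) ?s'" using gG s(2) by (simp add: P_def)
    moreover have "?g (inv ?g (d n)) = d n" using subgroup_inv_apply(2)[OF G(1) gG] .
    then have "d n \<in> ?g ` (snd s \<union> {x, d n, inv ?g (d n)})"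
      by (metis UnI2 image_eqI insertCI)
    then have "Q n s ?s'" using hx unfolding Q_def by (auto simp: pstab_def)
    ultimately show "\<exists>s'. P (Suc n) s' \<and> Q n s s'" by blast
  qed
  then obtain s where s: "\<And>n. P n (s n)" "\<And>n. Q n (s n) (s (Suc n))" by blast
  have "\<exists>h\<in>G. \<forall>i. \<forall>x\<in>snd (s i). h x = fst (s i) x"
  proof (rule closed_limit[OF G(2) subgroupD(1)[OF G(1)]])
    show "fst (s i) \<in> G" for i using s(1)[of i] by (simp add: P_def)
    show "snd (s i) \<subseteq> snd (s (Suc i))" for i using s(2)[of i] by (simp add: Q_def)
    show "fst (s (Suc i)) x = fst (s i) x" if "x \<in> snd (s i)" for i x
      using s(2)[of i] that by (simp add: Q_def)
    show "\<exists>i. x \<in> snd (s i)" for x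
    proof -
      obtain n where "x = d n" using d by blast
      then show ?thesis using s(2)[of n] by (auto simp: Q_def)
    qed
    show "\<exists>i. y \<in> fst (s i) ` snd (s i)" for y
    proof -
      obtain n where "y = d n" using d by blast
      then have "y \<in> fst (s (Suc n)) ` snd (s (Suc n))" using s(2)[of n] by (simp add: Q_def)
      then show ?thesis by blast
    qed
  qed
  then obtain h where h: "h \<in> G" "\<And>i x. x \<in> snd (s i) \<Longrightarrow> h x = fst (s i) x" by blast
  obtain k where k: "h \<in> W k" using cover h(1) by blast
  obtain x where x: "x \<in> snd (s (Suc k))" "fst (s (Suc k)) x \<notin> orbit (W k) x"
    using s(2)[of k] by (auto simp: Q_def)
  then have "h x \<notin> orbit (W k) x" using h(2) by simp
  then show False using k by (auto simp: orbit_def)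
qed

text \<open>\<open>W k\<close> consists of products of \<open>2 ^ k\<close> letters, where
  \<open>id\<close> is a letter and the letters are closed under inverses. Doubling the length at
  most squares the bound on the number of images of a point, since \<open>a (b x)\<close> is reached
  through \<open>b x\<close>.\<close>

lemma gen_bounded_cover:
  assumes H: "is_subgroup H" "\<And>x. finite (orbit H x) \<and> card (orbit H x) \<le> n"
    and U: "finite U" "U \<subseteq> Sym"
  shows "\<exists>W :: nat \<Rightarrow> _. gen (H \<union> U) \<subseteq> (\<Union>k. W k) \<and>
    (\<forall>k. \<exists>N. \<forall>x. finite (orbit (W k) x) \<and> card (orbit (W k) x) \<le> N)"
proof -
  define S where "S = insert id (H \<union> U \<union> inv ` U)"
  define step :: "('a \<Rightarrow> 'a) set \<Rightarrow> ('a \<Rightarrow> 'a) set" where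
    "step X = {a \<circ> b | a b. a \<in> X \<and> b \<in> X}" for X
  define W where "W k = (step ^^ k) S" for k
  have W0: "W 0 = S" and W_Suc: "W (Suc k) = step (W k)" for k by (simp_all add: W_def)
  have W_inv: "W k \<subseteq> Sym \<and> (\<forall>w\<in>W k. inv w \<in> W k) \<and> id \<in> W k" for k
  proof (induction k)
    case 0
    have "inv (inv u) = u" if "u \<in> U" for u using that U(2) by (auto simp: Sym_def inv_inv_eq)
    then show ?case
      using U(2) subgroupD(1,4)[OF H(1)] unfolding W0 S_def by (auto simp: Sym_def bij_imp_bij_inv)
  next
    case (Suc k)
    have "a \<circ> b \<in> Sym \<and> inv (a \<circ> b) \<in> step (W k)" if "a \<in> W k" "b \<in> W k" for a b
    proof -
      have "bij a" "bij b" using that Suc by (auto simp: Sym_def)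
      then have "bij (a \<circ> b)" "inv (a \<circ> b) = inv b \<circ> inv a" by (simp_all add: bij_comp o_inv_distrib)
      moreover have "inv b \<in> W k" "inv a \<in> W k" using that Suc by auto
      ultimately show ?thesis unfolding step_def Sym_def by blast
    qed
    then have "w \<in> Sym \<and> inv w \<in> step (W k)" if "w \<in> step (W k)" for w
      using that unfolding step_def[of "W k"] by blast
    moreover have "id \<circ> id \<in> step (W k)" using Suc unfolding step_def by blast
    then have "id \<in> step (W k)" by (simp only: comp_id)
    ultimately show ?case unfolding W_Suc by blast
  qed
  have W_mono: "W i \<subseteq> W j" if "i \<le> j" for i j
  proof (rule lift_Suc_mono_le[OF _ that])
    fix k
    have "w \<in> step (W k)" if "w \<in> W k" for w
    proof -
      have "w \<circ> id \<in> step (W k)" unfolding step_def using that W_inv by blast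
      then show ?thesis by simp
    qed
    then show "W k \<subseteq> W (Suc k)" unfolding W_Suc by blast
  qed
  have "g \<in> (\<Union>k. W k)" if "g \<in> gen (H \<union> U)" for g
    using that
  proof induction
    case gen_id
    show ?case using W_inv by blast
  next
    case (gen_gen u)
    then have "u \<in> W 0" unfolding W0 S_def by blast
    then show ?case by blast
  next
    case (gen_inv g)
    then show ?case using W_inv by blast
  next
    case (gen_comp g h)
    then obtain i j where ij: "g \<in> W i" "h \<in> W j" by auto
    have "g \<in> W (max i j)" "h \<in> W (max i j)"
      using W_mono[of i "max i j"] W_mono[of j "max i j"] ij by auto
    then have "g \<circ> h \<in> W (Suc (max i j))" unfolding W_Suc step_def by blast
    then show ?case by blast
  qed
  moreover have "\<exists>N. \<forall>x. finite (orbit (W k) x) \<and> card (orbit (W k) x) \<le> N" for k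
  proof (induction k)
    case 0
    have "finite (orbit (W 0) x) \<and> card (orbit (W 0) x) \<le> n + card (insert id (U \<union> inv ` U))" for x
    proof -
      let ?V = "insert id (U \<union> inv ` U)"
      have eq: "orbit (W 0) x = orbit H x \<union> (\<lambda>u. u x) ` ?V"
        unfolding W0 S_def orbit_eq_image by blast
      have "finite ?V" using U(1) by simp
      then have "card ((\<lambda>u. u x) ` ?V) \<le> card ?V" by (rule card_image_le)
      moreover have "card (orbit (W 0) x) \<le> card (orbit H x) + card ((\<lambda>u. u x) ` ?V)"
        unfolding eq by (rule card_Un_le)
      moreover have "finite (orbit (W 0) x)" unfolding eq using \<open>finite ?V\<close> H(2) by blast
      ultimately show ?thesis using H(2)[of x] by linarith
    qed
    then show ?case by blast
  next
    case (Suc k)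
    then obtain N where N: "\<And>x. finite (orbit (W k) x) \<and> card (orbit (W k) x) \<le> N" by blast
    have "finite (orbit (W (Suc k)) x) \<and> card (orbit (W (Suc k)) x) \<le> N * N" for x
    proof -
      have eq: "orbit (W (Suc k)) x = (\<Union>y\<in>orbit (W k) x. orbit (W k) y)"
        unfolding W_Suc step_def orbit_def by (auto; metis comp_apply)
      have "card (\<Union>y\<in>orbit (W k) x. orbit (W k) y) \<le> (\<Sum>y\<in>orbit (W k) x. card (orbit (W k) y))"
        using N by (intro card_UN_le) blast
      also have "\<dots> \<le> of_nat (card (orbit (W k) x)) * N"
        using N by (intro sum_bounded_above) blast
      also have "\<dots> \<le> N * N" using N by simp
      finally show ?thesis unfolding eq using N by auto
    qed
    then show ?case by blast
  qed
  ultimately show ?thesis by blast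
qed

text \<open>By \<open>closed_subgroup_cover\<close> some \<open>g\<close> maps each orbit of a
  stabilizer injectively into the set of images of a point under a single \<open>W k\<close>, and
  these sets have bounded size.\<close>

lemma bounded_orbits_if_preceq:
  fixes G :: "('a \<Rightarrow> 'a) set"
  assumes cnt: "countable (UNIV :: 'a set)" and G: "is_subgroup G" "closed_in_Sym G"
    and H: "is_subgroup H" "\<And>x. finite (orbit H x) \<and> card (orbit H x) \<le> n"
    and "preceq G H"
  shows "\<exists>\<Gamma> N. finite \<Gamma> \<and> (\<forall>x. finite (orbit (pstab G \<Gamma>) x) \<and> card (orbit (pstab G \<Gamma>) x) \<le> N)"
proof -
  obtain U where U: "finite U" "U \<subseteq> Sym" "G \<subseteq> gen (H \<union> U)"
    using assms(6) by (auto simp: preceq_def)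
  obtain W :: "nat \<Rightarrow> ('a \<Rightarrow> 'a) set" where W: "gen (H \<union> U) \<subseteq> (\<Union>k. W k)"
      "\<And>k. \<exists>N. \<forall>x. finite (orbit (W k) x) \<and> card (orbit (W k) x) \<le> N"
    using gen_bounded_cover[OF H U(1,2)] by blast
  obtain k \<Gamma> g where \<Gamma>: "finite \<Gamma>" "g \<in> G" "\<And>h x. h \<in> pstab G \<Gamma> \<Longrightarrow> g (h x) \<in> orbit (W k) x"
    using closed_subgroup_cover[OF cnt G order_trans[OF U(3) W(1)]] by blast
  obtain N where N: "\<And>x. finite (orbit (W k) x) \<and> card (orbit (W k) x) \<le> N" using W(2) by blast
  have "finite (orbit (pstab G \<Gamma>) x) \<and> card (orbit (pstab G \<Gamma>) x) \<le> N" for x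
  proof -
    have sub: "g ` orbit (pstab G \<Gamma>) x \<subseteq> orbit (W k) x" using \<Gamma>(3) by (auto simp: orbit_def[of "pstab G \<Gamma>"])
    have inj: "inj_on g (orbit (pstab G \<Gamma>) x)"
      using subgroupD(5)[OF G(1) \<Gamma>(2)] by (meson bij_is_inj inj_on_subset subset_UNIV)
    have "finite (g ` orbit (pstab G \<Gamma>) x)" using sub N finite_subset by blast
    then have "finite (orbit (pstab G \<Gamma>) x)" using inj finite_imageD by blast
    moreover have "card (orbit (pstab G \<Gamma>) x) \<le> card (orbit (W k) x)"
      using card_image[OF inj] card_mono[OF _ sub] N by metis
    ultimately show ?thesis using N[of x] by linarith
  qed
  then show ?thesis using \<Gamma>(1) by blast
qed

text \<open>A coset of \<open>pstab G \<Gamma>\<close> is determined by the images of the finitely many points of \<open>\<Gamma>\<close>.\<close>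

lemma countable_coset_representatives:
  fixes G :: "('a \<Rightarrow> 'a) set"
  assumes cnt: "countable (UNIV :: 'a set)" and G: "is_subgroup G" and "finite \<Gamma>"
  shows "\<exists>C. countable C \<and> C \<subseteq> G \<and> (\<forall>g\<in>G. \<exists>r\<in>C. \<exists>h\<in>pstab G \<Gamma>. g = r \<circ> h)"
proof -
  obtain xs where xs: "set xs = \<Gamma>" using finite_list[OF assms(3)] by blast
  define T where "T = (\<lambda>g. map g xs) ` G"
  have "T \<subseteq> lists UNIV" by auto
  moreover have "countable (lists (UNIV :: 'a set))" using cnt by (rule countable_lists)
  ultimately have "countable T" by (rule countable_subset)
  have "\<exists>r\<in>G. map r xs = t" if "t \<in> T" for t using that by (auto simp: T_def)
  then obtain r where r: "\<And>t. t \<in> T \<Longrightarrow> r t \<in> G" "\<And>t. t \<in> T \<Longrightarrow> map (r t) xs = t" by metis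
  have "\<exists>r'\<in>r ` T. \<exists>h\<in>pstab G \<Gamma>. g = r' \<circ> h" if g: "g \<in> G" for g
  proof -
    define r' where "r' = r (map g xs)"
    have t: "map g xs \<in> T" using g unfolding T_def by (rule imageI)
    then have r': "r' \<in> G" "map r' xs = map g xs" using r by (simp_all add: r'_def)
    have "inv r' (g x) = x" if "x \<in> \<Gamma>" for x
    proof -
      have "r' x = g x" using r'(2) that xs by (simp add: map_eq_conv)
      then show ?thesis using subgroup_inv_apply(1)[OF G r'(1), of x] by simp
    qed
    then have "inv r' \<circ> g \<in> pstab G \<Gamma>" using subgroupD(3,4)[OF G] r'(1) g by (simp add: pstab_def)
    moreover have "g = r' \<circ> (inv r' \<circ> g)"
      using subgroup_inv_apply(2)[OF G r'(1)] by (simp add: fun_eq_iff)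
    ultimately show ?thesis using t unfolding r'_def by blast
  qed
  then show ?thesis using \<open>countable T\<close> r(1) by (intro exI[of _ "r ` T"]) auto
qed

text \<open>\<open>G\<close> is generated by the stabilizer and countably many coset
  representatives, which lie in a finitely generated group.\<close>

lemma preceq_pstab:
  fixes G :: "('a \<Rightarrow> 'a) set"
  assumes cnt: "countable (UNIV :: 'a set)" "infinite (UNIV :: 'a set)"
    and G: "is_subgroup G" and "finite \<Gamma>"
  shows "preceq G (pstab G \<Gamma>)"
proof -
  obtain C where C: "countable C" "C \<subseteq> G" "\<And>g. g \<in> G \<Longrightarrow> \<exists>r\<in>C. \<exists>h\<in>pstab G \<Gamma>. g = r \<circ> h"
    using countable_coset_representatives[OF cnt(1) G assms(4)] by blast
  obtain U where U: "finite U" "U \<subseteq> Sym" "C \<subseteq> gen U"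
    using countable_finitely_generated[OF cnt C(1) order_trans[OF C(2) subgroupD(1)[OF G]]] by blast
  have "g \<in> gen (pstab G \<Gamma> \<union> U)" if g: "g \<in> G" for g
  proof -
    obtain r h where rh: "r \<in> C" "h \<in> pstab G \<Gamma>" "g = r \<circ> h" using C(3)[OF g] by blast
    have "r \<in> gen (pstab G \<Gamma> \<union> U)" using rh(1) U(3) gen_mono[of U "pstab G \<Gamma> \<union> U"] by blast
    moreover have "h \<in> gen (pstab G \<Gamma> \<union> U)" using rh(2) by (simp add: gen_gen)
    ultimately show ?thesis unfolding rh(3) by (rule gen_comp)
  qed
  then show ?thesis unfolding preceq_def using U(1,2) by blast
qed

lemma countable_if_pstab_trivial:
  fixes G :: "('a \<Rightarrow> 'a) set"
  assumes "countable (UNIV :: 'a set)" "is_subgroup G" "finite \<Gamma>" "pstab G \<Gamma> = {id}"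
  shows "countable G"
proof -
  obtain C where C: "countable C" "C \<subseteq> G" "\<And>g. g \<in> G \<Longrightarrow> \<exists>r\<in>C. \<exists>h\<in>pstab G \<Gamma>. g = r \<circ> h"
    using countable_coset_representatives[OF assms(1-3)] by blast
  have "G \<subseteq> C"
  proof
    fix g assume "g \<in> G"
    then obtain r h where rh: "r \<in> C" "h \<in> pstab G \<Gamma>" "g = r \<circ> h" using C(3) by blast
    then have "h = id" using assms(4) by simp
    then show "g \<in> C" using rh by simp
  qed
  then show ?thesis using C(1) countable_subset by blast
qed

subsection \<open>Independently moved points\<close>

lemma orbit_self: "is_subgroup G \<Longrightarrow> x \<in> orbit G x"
  unfolding orbit_eq_image using subgroupD(2) by (metis id_apply image_eqI)

lemma orbit_closed:
  assumes "is_subgroup G" "y \<in> orbit G x" "g \<in> G" shows "g y \<in> orbit G x"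
proof -
  obtain h where h: "h \<in> G" "y = h x" using assms(2) by (auto simp: orbit_def)
  then have "g \<circ> h \<in> G" using subgroupD(3)[OF assms(1,3)] by blast
  then have "(g \<circ> h) x \<in> orbit G x" unfolding orbit_eq_image by (rule imageI)
  then show ?thesis using h by simp
qed

lemma orbit_sym:
  assumes "is_subgroup G" "y \<in> orbit G x" shows "x \<in> orbit G y"
proof -
  obtain h where h: "h \<in> G" "y = h x" using assms(2) by (auto simp: orbit_def)
  then have "inv h y = x" using subgroup_inv_apply(1)[OF assms(1)] by simp
  moreover have "inv h y \<in> orbit G y"
    unfolding orbit_eq_image using subgroupD(4)[OF assms(1) h(1)] by (rule imageI)
  ultimately show ?thesis by simp
qed

lemma orbit_subset:
  assumes "is_subgroup G" "y \<in> orbit G x" shows "orbit G y \<subseteq> orbit G x"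
  using orbit_closed[OF assms] by (auto simp: orbit_def[of G y])

lemma orbit_eq:
  assumes "is_subgroup G" "y \<in> orbit G x" shows "orbit G y = orbit G x"
  using orbit_subset[OF assms] orbit_subset[OF assms(1) orbit_sym[OF assms]] by blast

text \<open>The points are chosen one after the other. \<open>\<Gamma> n\<close> is a finite
  \<open>G\<close>-invariant set containing all earlier orbits, and \<open>x n\<close> has its full
  orbit already under the stabilizer of \<open>\<Gamma> n\<close>. Invariance separates the orbits,
  and fullness allows \<open>x n\<close> to be moved after the earlier images have been
  settled.\<close>

lemma independent_points:
  fixes G :: "('a \<Rightarrow> 'a) set"
  assumes cnt: "countable (UNIV :: 'a set)" and G: "is_subgroup G" "closed_in_Sym G"
    and fin: "\<And>x. finite (orbit G x)"
    and full: "\<And>\<Gamma>. finite \<Gamma> \<Longrightarrow> \<exists>x. orbit (pstab G \<Gamma>) x = orbit G x \<and> orbit G x \<noteq> {x}"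
  obtains x z :: "nat \<Rightarrow> 'a" where
    "\<And>i. z i \<noteq> x i" "\<And>i. z i \<in> orbit G (x i)"
    "\<And>i j. i \<noteq> j \<Longrightarrow> orbit G (x i) \<inter> orbit G (x j) = {}"
    "\<And>T. \<exists>g\<in>G. \<forall>i. g (x i) = (if i \<in> T then z i else x i)"
proof -
  define d :: "nat \<Rightarrow> 'a" where "d = from_nat_into UNIV"
  have d: "surj d" unfolding d_def using range_from_nat_into[OF UNIV_not_empty cnt] .
  define P :: "nat \<Rightarrow> 'a \<times> 'a set \<Rightarrow> bool" where
    "P n s \<longleftrightarrow> finite (snd s) \<and> (\<forall>g\<in>G. \<forall>y\<in>snd s. g y \<in> snd s) \<and>
      orbit (pstab G (snd s)) (fst s) = orbit G (fst s) \<and> orbit G (fst s) \<noteq> {fst s}" for n s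
  define Q where "Q n s s' \<longleftrightarrow> snd s' = snd s \<union> orbit G (fst s) \<union> orbit G (d n)"
    for n and s s' :: "'a \<times> 'a set"
  have "\<exists>s. \<forall>n. P n (s n) \<and> Q n (s n) (s (Suc n))"
  proof (rule dependent_nat_choice)
    obtain x where "orbit (pstab G {}) x = orbit G x \<and> orbit G x \<noteq> {x}" using full by blast
    then show "\<exists>s. P 0 s" by (intro exI[of _ "(x, {})"]) (simp add: P_def)
    fix s n assume "P n s"
    then have s: "finite (snd s)" "\<And>g y. g \<in> G \<Longrightarrow> y \<in> snd s \<Longrightarrow> g y \<in> snd s"
      by (auto simp: P_def)
    \<comment> \<open>Adding the orbit of \<open>d n\<close> makes the sets exhaust
      \<Omega>.\<close>
    let ?\<Gamma> = "snd s \<union> orbit G (fst s) \<union> orbit G (d n)"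
    have "finite ?\<Gamma>" using s(1) fin by simp
    moreover from full[OF this] obtain x where "orbit (pstab G ?\<Gamma>) x = orbit G x \<and> orbit G x \<noteq> {x}" ..
    moreover have "\<forall>g\<in>G. \<forall>y\<in>?\<Gamma>. g y \<in> ?\<Gamma>" using s(2) orbit_closed[OF G(1)] by blast
    ultimately have "P (Suc n) (x, ?\<Gamma>)" unfolding P_def by simp
    moreover have "Q n s (x, ?\<Gamma>)" by (simp add: Q_def)
    ultimately show "\<exists>s'. P (Suc n) s' \<and> Q n s s'" by blast
  qed
  then obtain s where s: "\<And>n. P n (s n)" "\<And>n. Q n (s n) (s (Suc n))" by blast
  define x where "x n = fst (s n)" for n
  define \<Gamma> where "\<Gamma> n = snd (s n)" for n
  have inv\<Gamma>: "g y \<in> \<Gamma> n" if "g \<in> G" "y \<in> \<Gamma> n" for g y n using s(1)[of n] that by (simp add: P_def \<Gamma>_def)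
  have orb: "orbit (pstab G (\<Gamma> n)) (x n) = orbit G (x n)" "orbit G (x n) \<noteq> {x n}" for n
    using s(1)[of n] by (simp_all add: P_def \<Gamma>_def x_def)
  have \<Gamma>_Suc: "\<Gamma> (Suc n) = \<Gamma> n \<union> orbit G (x n) \<union> orbit G (d n)" for n
    using s(2)[of n] by (simp add: Q_def \<Gamma>_def x_def)
  have \<Gamma>_mono: "\<Gamma> i \<subseteq> \<Gamma> j" if "i \<le> j" for i j
    by (rule lift_Suc_mono_le[of \<Gamma>, OF _ that]) (auto simp: \<Gamma>_Suc)
  have x_in: "x n \<in> \<Gamma> (Suc n)" for n using orbit_self[OF G(1)] by (simp add: \<Gamma>_Suc)
  have x_notin: "x n \<notin> \<Gamma> n" for n
  proof
    assume "x n \<in> \<Gamma> n"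
    then have "orbit (pstab G (\<Gamma> n)) (x n) \<subseteq> {x n}" by (auto simp: orbit_def pstab_def)
    then show False using orb[of n] orbit_self[OF G(1)] by blast
  qed
  have "\<exists>z. z \<in> orbit G (x n) \<and> z \<noteq> x n" for n
    using orb(2)[of n] orbit_self[OF G(1), of "x n"] by blast
  then obtain z where z: "\<And>n. z n \<in> orbit G (x n)" "\<And>n. z n \<noteq> x n" by metis
  have disj: "orbit G (x i) \<inter> orbit G (x j) = {}" if "i < j" for i j
  proof (rule ccontr)
    assume "orbit G (x i) \<inter> orbit G (x j) \<noteq> {}"
    then obtain y where y: "y \<in> orbit G (x i)" "y \<in> orbit G (x j)" by blast
    then have "y \<in> \<Gamma> j" using \<Gamma>_mono[of "Suc i" j] that by (auto simp: \<Gamma>_Suc)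
    moreover have "x j \<in> orbit G y" using orbit_sym[OF G(1) y(2)] .
    ultimately have "x j \<in> \<Gamma> j" using inv\<Gamma> by (auto simp: orbit_def)
    then show False using x_notin by blast
  qed
  \<comment> \<open>Arbitrary targets in the orbits can be met at once; the choice between
    \<open>x i\<close> and \<open>z i\<close> is a special case.\<close>
  have indep: "\<exists>g\<in>G. \<forall>i. g (x i) = t i" if t: "\<And>i. t i \<in> orbit G (x i)" for t
  proof -
    have "\<exists>g. \<forall>n. g n \<in> G \<and> ((\<forall>y\<in>\<Gamma> n. g (Suc n) y = g n y) \<and> g (Suc n) (x n) = t n)"
    proof (rule dependent_nat_choice)
      show "\<exists>g. g \<in> G" using subgroupD(2)[OF G(1)] by blast
      fix g n assume g: "g \<in> G"
      \<comment> \<open>The correction \<open>a\<close> acts before \<open>g\<close>, so the target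
        has to be pulled back by \<open>g\<close>; it stays in the orbit of \<open>x n\<close>,
        which fullness makes accessible without moving \<open>\<Gamma> n\<close>.\<close>
      have "inv g (t n) \<in> orbit (pstab G (\<Gamma> n)) (x n)"
        unfolding orb(1) using orbit_closed[OF G(1) t subgroupD(4)[OF G(1) g]] .
      then obtain a where a: "a \<in> pstab G (\<Gamma> n)" "inv g (t n) = a (x n)" by (auto simp: orbit_def)
      have "g \<circ> a \<in> G" using a(1) g subgroupD(3)[OF G(1)] by (simp add: pstab_def)
      moreover have "(g \<circ> a) (x n) = t n"
        using a(2)[symmetric] subgroup_inv_apply(2)[OF G(1) g] by simp
      moreover have "\<forall>y\<in>\<Gamma> n. (g \<circ> a) y = g y" using a(1) by (simp add: pstab_def)
      ultimately show "\<exists>g'. g' \<in> G \<and> ((\<forall>y\<in>\<Gamma> n. g' y = g y) \<and> g' (x n) = t n)" by blast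
    qed
    then obtain g where g: "\<And>n. g n \<in> G" "\<And>n y. y \<in> \<Gamma> n \<Longrightarrow> g (Suc n) y = g n y"
        "\<And>n. g (Suc n) (x n) = t n" by blast
    have dom: "\<exists>i. y \<in> \<Gamma> i" for y
    proof -
      obtain n where "y = d n" using d by blast
      then have "y \<in> \<Gamma> (Suc n)" using orbit_self[OF G(1)] by (simp add: \<Gamma>_Suc)
      then show ?thesis by blast
    qed
    \<comment> \<open>Each \<open>g i\<close> maps the invariant set \<open>\<Gamma> i\<close> onto
      itself, so the images exhaust \<Omega> as well.\<close>
    have ran: "\<exists>i. y \<in> g i ` \<Gamma> i" for y
    proof -
      obtain i where "y \<in> \<Gamma> i" using dom by blast
      then have "inv (g i) y \<in> \<Gamma> i" using inv\<Gamma> subgroupD(4)[OF G(1) g(1)] by blast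
      then have "g i (inv (g i) y) \<in> g i ` \<Gamma> i" by (rule imageI)
      then show ?thesis using subgroup_inv_apply(2)[OF G(1) g(1)] by auto
    qed
    have "\<exists>h\<in>G. \<forall>i. \<forall>y\<in>\<Gamma> i. h y = g i y"
      by (rule closed_limit[OF G(2) subgroupD(1)[OF G(1)] g(1) _ g(2) dom ran]) (auto simp: \<Gamma>_Suc)
    then obtain h where h: "h \<in> G" "\<And>i y. y \<in> \<Gamma> i \<Longrightarrow> h y = g i y" by blast
    have "h (x i) = t i" for i using h(2)[OF x_in] g(3) by simp
    then show ?thesis using h(1) by blast
  qed
  show ?thesis
  proof (rule that[of z x])
    show "orbit G (x i) \<inter> orbit G (x j) = {}" if "i \<noteq> j" for i j
      using that disj[of i j] disj[of j i] by (cases "i < j") auto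
    show "\<exists>g\<in>G. \<forall>i. g (x i) = (if i \<in> T then z i else x i)" for T
      using indep[of "\<lambda>i. if i \<in> T then z i else x i"] z(1) orbit_self[OF G(1)] by simp
  qed (use z in auto)
qed

text \<open>The grid on which the flips are produced: in cell \<open>(j, k)\<close> the positions \<open>0\<close> and \<open>1\<close>
  will be two points of one orbit, so that \<open>G\<close> can exchange the transpositions \<open>(0 2)\<close> and
  \<open>(1 2)\<close> independently in all cells.\<close>

definition cell_swaps :: "(nat \<times> int) set \<Rightarrow> nat \<times> int \<times> nat \<Rightarrow> nat \<times> int \<times> nat" where
  "cell_swaps T = (\<lambda>(j, k, m). (j, k, if (j, k) \<in> T then transpose 1 2 m else transpose 0 2 m))"

lemma cell_swaps_involution: "cell_swaps T \<circ> cell_swaps T = id"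
  by (auto simp: cell_swaps_def fun_eq_iff)

lemma bij_cell_swaps: "bij (cell_swaps T)"
  using cell_swaps_involution o_bij by blast

text \<open>In the cells of \<open>T\<close>, \<open>c T\<close> is a 3-cycle on positions 0, 1, 2.
  Its product with its conjugate by (2 3) is the double transposition (0 2)(1 3). Shifting positions
  1 and 3 along \<open>k\<close> tells the two factors apart.\<close>

lemma flips_from_cell_swaps:
  "\<exists>V. finite V \<and> V \<subseteq> Sym \<and> (\<forall>T. transport (\<lambda>(j, b). (j, 0, if b then 1 else 3)) (flip T)
    \<in> gen (range cell_swaps \<union> V))"
proof -
  define v :: "nat \<times> int \<times> nat \<Rightarrow> nat \<times> int \<times> nat" where
    "v = (\<lambda>(j, k, m). (j, k, transpose 2 3 m))"
  define s :: "nat \<times> int \<times> nat \<Rightarrow> nat \<times> int \<times> nat" where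
    "s = (\<lambda>(j, k, m). (j, if m = 1 \<or> m = 3 then k + 1 else k, m))"
  define s' :: "nat \<times> int \<times> nat \<Rightarrow> nat \<times> int \<times> nat" where
    "s' = (\<lambda>(j, k, m). (j, if m = 1 \<or> m = 3 then k - 1 else k, m))"
  have "bij v" by (rule o_bij[of v]) (auto simp: v_def fun_eq_iff)
  moreover have "bij s" by (rule o_bij[of s']) (auto simp: s_def s'_def fun_eq_iff)
  moreover have "bij s'" by (rule o_bij[of s]) (auto simp: s_def s'_def fun_eq_iff)
  ultimately have V: "{v, s, s'} \<subseteq> Sym" by (simp add: Sym_def)
  let ?K = "range cell_swaps \<union> {v, s, s'}"
  define c where "c T = cell_swaps T \<circ> cell_swaps {}" for T
  define D where "D T = c T \<circ> (v \<circ> c T \<circ> v)" for T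
  have c: "c T = (\<lambda>(j, k, m). (j, k, if (j, k) \<in> T then
      (if m = 0 then 1 else if m = 1 then 2 else if m = 2 then 0 else m) else m))" for T
    by (auto simp: c_def cell_swaps_def fun_eq_iff transpose_def)
  have D: "D T = (\<lambda>(j, k, m). (j, k, if (j, k) \<in> T then
      (if m = 0 then 2 else if m = 2 then 0 else if m = 1 then 3 else if m = 3 then 1 else m) else m))" for T
    by (auto simp: D_def c v_def fun_eq_iff transpose_def)
  have vss: "v \<in> gen ?K" "s \<in> gen ?K" "s' \<in> gen ?K" by (auto intro: gen_gen)
  have "cell_swaps T \<in> gen ?K" for T by (auto intro: gen_gen)
  then have cT: "c T \<in> gen ?K" for T unfolding c_def by (intro gen_comp)
  have DT: "D T \<in> gen ?K" for T unfolding D_def by (intro gen_comp cT vss)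
  have "transport (\<lambda>(j, b). (j, 0, if b then 1 else 3)) (flip T) \<in> gen ?K" for T
  proof -
    \<comment> \<open>On this half-line the shifted copy has (0 2) at all \<open>k \<ge> 0\<close>
      but (1 3) only at \<open>k \<ge> 1\<close>. In the product only (1 3) at \<open>k = 0\<close>
      remains.\<close>
    let ?T = "{(j, k). j \<in> T \<and> k \<ge> 0}"
    have "transport (\<lambda>(j, b). (j, 0, if b then 1 else 3)) (flip T) = D ?T \<circ> (s \<circ> D ?T \<circ> s')"
    proof (rule transport_eqI)
      show "inj (\<lambda>(j :: nat, b). (j, 0 :: int, if b then 1 else 3 :: nat))"
        by (auto simp: inj_def split: if_splits)
      show "(D ?T \<circ> (s \<circ> D ?T \<circ> s')) ((\<lambda>(j, b). (j, 0, if b then 1 else 3)) x)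
          = (\<lambda>(j, b). (j, 0, if b then 1 else 3)) (flip T x)" for x
        by (cases x) (auto simp: D s_def s'_def flip_def)
      show "(D ?T \<circ> (s \<circ> D ?T \<circ> s')) y = y"
        if "y \<notin> range (\<lambda>(j, b). (j, 0, if b then 1 else 3))" for y
      proof -
        obtain j k m where y: "y = (j, k, m)" using prod_cases3 by blast
        have "\<not> (k = 0 \<and> (m = 1 \<or> m = 3))"
        proof
          assume "k = 0 \<and> (m = 1 \<or> m = 3)"
          then have "y = (\<lambda>(j, b). (j, 0, if b then 1 else 3)) (j, m = 1)" using y by auto
          then show False using that by blast
        qed
        then show ?thesis unfolding y by (auto simp: D s_def s'_def)
      qed
    qed
    then show ?thesis using DT vss by (simp only:) (intro gen_comp)
  qed
  then show ?thesis using V by (intro exI[of _ "{v, s, s'}"]) auto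
qed

text \<open>The grid is laid out with \<open>x (c j k 0)\<close> and \<open>z (c j k 0)\<close> at
  positions 0 and 1 of a cell. Let \<open>u\<close> be the product of all transpositions (0 2).
  Conjugating \<open>u\<close> by an element of \<open>G\<close> that moves position 0 to position 1
  exactly in the cells of \<open>T\<close> gives \<open>cell_swaps T\<close>, so \<open>u\<close> is
  the only generator needed for all of them.\<close>

lemma flips_preceq_if_independent_points:
  fixes G :: "('a \<Rightarrow> 'a) set"
  assumes G: "is_subgroup G"
    and z: "\<And>i. z i \<noteq> x i" "\<And>i. z i \<in> orbit G (x i)"
    and disj: "\<And>i j. i \<noteq> j \<Longrightarrow> orbit G (x i) \<inter> orbit G (x j) = {}"
    and indep: "\<And>T. \<exists>g\<in>G. \<forall>i. g (x i) = (if i \<in> T then z i else x (i :: nat))"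
  obtains q :: "nat \<times> bool \<Rightarrow> 'a" where "inj q" "infinite (- range q)" "preceq (flips q) G"
proof -
  define c where "c j k m = to_nat (j, k, m)" for j :: nat and k :: int and m :: nat
  have c_eq: "c j k m = c j' k' m' \<longleftrightarrow> j = j' \<and> k = k' \<and> m = m'" for j k m j' k' m'
    by (simp add: c_def)
  have same: "i = j" if "y \<in> orbit G (x i)" "y \<in> orbit G (x j)" for i j y
    using disj[of i j] that by blast
  have x_orb: "x i \<in> orbit G (x i)" for i using orbit_self[OF G] .
  have x_eq: "x i = x j \<longleftrightarrow> i = j" for i j using same[of "x i" i j] x_orb[of i] x_orb[of j] by auto
  have z_eq: "z i = z j \<longleftrightarrow> i = j" for i j using same[of "z i" i j] z(2)[of i] z(2)[of j] by auto
  have zx: "z i \<noteq> x j" for i j using same[of "z i" i j] z[of i] x_orb[of j] by auto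
  define p where "p = (\<lambda>(j, k, m). if m = 1 then z (c j k 0) else x (c j k m))"
  have p: "inj p"
    by (rule injI) (auto simp: p_def x_eq z_eq zx zx[symmetric] c_eq split: if_splits)
  have p_coinf: "infinite (- range p)"
  proof
    assume "finite (- range p)"
    \<comment> \<open>Position 1 is taken by a \<open>z\<close>, so the points
      \<open>x (c j k 1)\<close> stay off the grid.\<close>
    moreover have "range (\<lambda>j. x (c j 0 1)) \<subseteq> - range p"
      by (auto simp: p_def x_eq zx zx[symmetric] c_eq split: if_splits)
    moreover have "inj (\<lambda>j. x (c j 0 1))" by (rule injI) (simp add: x_eq c_eq)
    ultimately show False using finite_subset range_inj_infinite by blast
  qed
  define u where "u = transport p (cell_swaps {})"
  have in_G: "transport p (cell_swaps T) \<in> gen (G \<union> {u})" for T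
  proof -
    obtain g where g: "g \<in> G"
      "\<And>i. g (x i) = (if i \<in> (\<lambda>(j, k). c j k 0) ` T then z i else x i)"
      using indep by blast
    have g0: "g (x (c j k m)) = (if m = 0 \<and> (j, k) \<in> T then z (c j k 0) else x (c j k m))" for j k m
      unfolding g(2) by (auto simp: c_eq)
    have g_bij: "bij g" using subgroupD(5)[OF G g(1)] .
    define \<sigma> :: "nat \<times> int \<times> nat \<Rightarrow> nat \<times> int \<times> nat" where
      "\<sigma> = (\<lambda>(j, k, m). (j, k, if (j, k) \<in> T then transpose 0 1 m else m))"
    have \<sigma>: "bij \<sigma>" by (rule o_bij[of \<sigma>]) (auto simp: \<sigma>_def fun_eq_iff)
    have "g \<circ> u \<circ> inv g = transport (g \<circ> p) (cell_swaps {})"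
      unfolding u_def by (rule transport_conj[OF p g_bij])
    also have "\<dots> = transport (p \<circ> \<sigma>) (cell_swaps {})"
    \<comment> \<open>Where \<open>g\<close> sends the points at position 1 is unknown. This is
      harmless, since \<open>cell_swaps {}\<close> moves only positions 0 and 2, where
      \<open>g \<circ> p\<close> and \<open>p \<circ> \<sigma>\<close> agree.\<close>
    proof (rule transport_cong)
      show "inj (g \<circ> p)" using p g_bij by (simp add: inj_compose bij_is_inj)
      show "inj (p \<circ> \<sigma>)" using p \<sigma> by (simp add: inj_compose bij_is_inj)
      show "inj (cell_swaps {})" using bij_cell_swaps bij_is_inj by blast
      fix y assume "cell_swaps {} y \<noteq> y"
      then obtain j k m where y: "y = (j, k, m)" "m = 0 \<or> m = 2"
        by (cases y) (auto simp: cell_swaps_def transpose_def split: if_splits)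
      then show "(g \<circ> p) y = (p \<circ> \<sigma>) y"
        by (auto simp: p_def \<sigma>_def g0 transpose_def)
    qed
    also have "\<dots> = transport p (transport \<sigma> (cell_swaps {}))"
      using transport_transport[OF p bij_is_inj[OF \<sigma>]] by simp
    also have "transport \<sigma> (cell_swaps {}) = cell_swaps T"
    proof (rule transport_eqI)
      show "inj \<sigma>" using \<sigma> bij_is_inj by blast
      show "cell_swaps T (\<sigma> y) = \<sigma> (cell_swaps {} y)" for y
        by (cases y) (auto simp: cell_swaps_def \<sigma>_def transpose_def)
      show "cell_swaps T y = y" if "y \<notin> range \<sigma>" for y
        using that \<sigma> by (simp add: bij_is_surj)
    qed
    finally have eq: "g \<circ> u \<circ> inv g = transport p (cell_swaps T)" .
    have "g \<in> gen (G \<union> {u})" "u \<in> gen (G \<union> {u})" using g(1) by (auto intro: gen_gen)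
    then have "g \<circ> u \<circ> inv g \<in> gen (G \<union> {u})" by (intro gen_comp gen_inv)
    then show ?thesis unfolding eq .
  qed
  let ?r = "\<lambda>(j :: nat, b). (j, 0 :: int, if b then 1 else 3 :: nat)"
  obtain V where V: "finite V" "V \<subseteq> Sym" "\<And>T. transport ?r (flip T) \<in> gen (range cell_swaps \<union> V)"
    using flips_from_cell_swaps by blast
  have r: "inj ?r" by (auto simp: inj_def split: if_splits)
  define q where "q = p \<circ> ?r"
  have q: "inj q" unfolding q_def using p r by (rule inj_compose)
  have "- range p \<subseteq> - range q" by (auto simp: q_def)
  then have q_coinf: "infinite (- range q)" using infinite_super[OF _ p_coinf] by blast
  let ?U = "insert u (transport p ` V)"
  have "range cell_swaps \<union> V \<subseteq> Sym" using V(2) bij_cell_swaps by (auto simp: Sym_def)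
  from transport_gen[OF p this V(3)]
  have 1: "transport p (transport ?r (flip T)) \<in> gen (transport p ` (range cell_swaps \<union> V))" for T .
  have "transport p ` (range cell_swaps \<union> V) \<subseteq> gen (G \<union> ?U)"
  proof -
    have "transport p (cell_swaps T) \<in> gen (G \<union> ?U)" for T
      using in_G[of T] gen_mono[of "G \<union> {u}" "G \<union> ?U"] by blast
    moreover have "transport p ` V \<subseteq> gen (G \<union> ?U)" by (auto intro: gen_gen)
    ultimately show ?thesis by blast
  qed
  from gen_least[OF this] have "transport p (transport ?r (flip T)) \<in> gen (G \<union> ?U)" for T using 1 by blast
  then have "flips q \<subseteq> gen (G \<union> ?U)"
    unfolding flips_def q_def transport_transport[OF p r, symmetric] by blast
  moreover have "?U \<subseteq> Sym"
    using V(2) transport_bij(1)[OF p] bij_cell_swaps by (auto simp: u_def Sym_def)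
  ultimately have "preceq (flips q) G" unfolding preceq_def using V(1) by (intro exI[of _ ?U]) simp
  then show ?thesis using that q q_coinf by blast
qed

subsection \<open>The classification\<close>

text \<open>The orbits of the stabilizer form a partition into bounded blocks, and the stabilizer
  preserves each block; \<open>preceq_pstab\<close> passes from \<open>G\<close> to the
  stabilizer.\<close>

lemma preceq_flips_if_bounded_orbits:
  fixes G :: "('a \<Rightarrow> 'a) set"
  assumes cnt: "countable (UNIV :: 'a set)" "infinite (UNIV :: 'a set)"
    and q: "inj q" "infinite (- range q)" and G: "is_subgroup G" and "finite \<Gamma>"
    and bound: "\<And>x. finite (orbit (pstab G \<Gamma>) x) \<and> card (orbit (pstab G \<Gamma>) x) \<le> n"
  shows "preceq G (flips q)"
proof -
  let ?H = "pstab G \<Gamma>" and ?A = "range (orbit (pstab G \<Gamma>))"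
  have H: "is_subgroup ?H" using is_subgroup_pstab[OF G] .
  have "is_partition ?A"
    unfolding is_partition_def
  proof (intro conjI ballI impI)
    show "{} \<notin> ?A" using orbit_self[OF H] by fastforce
    show "\<Union> ?A = UNIV" using orbit_self[OF H] by blast
    show "X \<inter> Y = {}" if XY: "X \<in> ?A" "Y \<in> ?A" "X \<noteq> Y" for X Y
    proof (rule ccontr)
      assume "X \<inter> Y \<noteq> {}"
      then obtain y where y: "y \<in> X" "y \<in> Y" by blast
      obtain a b where ab: "X = orbit ?H a" "Y = orbit ?H b" using XY(1,2) by blast
      have "X = Y" using orbit_eq[OF H, of y a] orbit_eq[OF H, of y b] y unfolding ab by simp
      then show False using XY(3) by simp
    qed
  qed
  then have S_part_le: "preceq (S_part ?A) (flips q)"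
    by (rule S_part_preceq_flips[OF cnt(1) q, of _ n]) (use bound in blast)
  have "?H \<subseteq> S_part ?A"
  proof
    fix h assume h: "h \<in> ?H"
    have "h ` orbit ?H x = orbit ?H x" for x
    proof
      show "h ` orbit ?H x \<subseteq> orbit ?H x" using orbit_closed[OF H _ h] by blast
      show "orbit ?H x \<subseteq> h ` orbit ?H x"
      proof
        fix y assume "y \<in> orbit ?H x"
        then have "inv h y \<in> orbit ?H x" using orbit_closed[OF H _ subgroupD(4)[OF H h]] by blast
        then have "h (inv h y) \<in> h ` orbit ?H x" by (rule imageI)
        then show "y \<in> h ` orbit ?H x" using subgroup_inv_apply(2)[OF H h] by simp
      qed
    qed
    then show "h \<in> S_part ?A" using h subgroupD(1)[OF H] by (auto simp: S_part_def)
  qed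
  then have "preceq ?H (flips q)" by (rule preceq_trans[OF preceq_subset S_part_le])
  then show ?thesis by (rule preceq_trans[OF preceq_pstab[OF cnt G assms(6)]])
qed

text \<open>Stabilizing further points cannot lower the least orbit bound; hence every smaller
  stabilizer still has an orbit that is a full orbit of the group.\<close>

lemma flips_preceq_if_bounded_orbits:
  fixes G :: "('a \<Rightarrow> 'a) set"
  assumes cnt: "countable (UNIV :: 'a set)" and G: "is_subgroup G" "closed_in_Sym G"
    and bounded: "finite \<Gamma>0" "\<And>x. finite (orbit (pstab G \<Gamma>0) x) \<and> card (orbit (pstab G \<Gamma>0) x) \<le> n0"
    and nontriv: "\<And>\<Gamma>. finite \<Gamma> \<Longrightarrow> pstab G \<Gamma> \<noteq> {id}"
  obtains q :: "nat \<times> bool \<Rightarrow> 'a" where "inj q" "infinite (- range q)" "preceq (flips q) G"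
proof -
  define B where "B n \<longleftrightarrow> (\<exists>\<Gamma>. finite \<Gamma> \<and>
    (\<forall>x. finite (orbit (pstab G \<Gamma>) x) \<and> card (orbit (pstab G \<Gamma>) x) \<le> n))" for n
  have "B n0" unfolding B_def using bounded by blast
  define n where "n = (LEAST n. B n)"
  have "B n" unfolding n_def using \<open>B n0\<close> by (rule LeastI)
  then obtain \<Gamma>1 where \<Gamma>1: "finite \<Gamma>1"
      "\<And>x. finite (orbit (pstab G \<Gamma>1) x) \<and> card (orbit (pstab G \<Gamma>1) x) \<le> n"
    unfolding B_def by blast
  define H where "H = pstab G \<Gamma>1"
  have H: "is_subgroup H" "closed_in_Sym H"
    unfolding H_def using is_subgroup_pstab[OF G(1)] closed_in_Sym_pstab[OF G(2)] by auto
  have fin: "finite (orbit H x)" and le_n: "card (orbit H x) \<le> n" for x using \<Gamma>1(2) by (auto simp: H_def)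
  \<comment> \<open>This makes the truncated \<open>n - 1\<close> a strictly smaller bound, and it
    ensures that orbits of size \<open>n\<close> are nontrivial.\<close>
  have "n \<ge> 2"
  proof (rule ccontr)
    assume "\<not> n \<ge> 2"
    have "h = id" if h: "h \<in> H" for h
    proof
      fix x
      have "h x \<in> orbit H x" using orbit_closed[OF H(1) orbit_self[OF H(1)] h] .
      moreover have "card (orbit H x) \<le> Suc 0" using le_n[of x] \<open>\<not> n \<ge> 2\<close> by linarith
      ultimately show "h x = id x"
        using orbit_self[OF H(1), of x] fin[of x] by (simp add: card_le_Suc0_iff_eq)
    qed
    then have "H = {id}" using subgroupD(2)[OF H(1)] by blast
    then show False using nontriv[OF \<Gamma>1(1)] by (simp add: H_def)
  qed
  then have "\<not> B (n - 1)" unfolding n_def[symmetric] using not_less_Least[of "n - 1" B] n_def by simp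
  have full: "\<exists>x. orbit (pstab H \<Gamma>) x = orbit H x \<and> orbit H x \<noteq> {x}" if "finite \<Gamma>" for \<Gamma>
  proof -
    have eq: "pstab H \<Gamma> = pstab G (\<Gamma>1 \<union> \<Gamma>)" by (auto simp: H_def pstab_def)
    have sub: "orbit (pstab H \<Gamma>) x \<subseteq> orbit H x" for x by (auto simp: orbit_def pstab_def)
    have fin': "finite (orbit (pstab H \<Gamma>) x)" for x using finite_subset[OF sub fin] .
    have "finite (\<Gamma>1 \<union> \<Gamma>)" using \<Gamma>1(1) that by simp
    then have "\<not> (\<forall>x. finite (orbit (pstab H \<Gamma>) x) \<and> card (orbit (pstab H \<Gamma>) x) \<le> n - 1)"
      unfolding eq using \<open>\<not> B (n - 1)\<close> unfolding B_def by blast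
    then obtain x where "\<not> card (orbit (pstab H \<Gamma>) x) \<le> n - 1" using fin' by blast
    then have "card (orbit H x) \<le> card (orbit (pstab H \<Gamma>) x)" using le_n[of x] by linarith
    then have "orbit (pstab H \<Gamma>) x = orbit H x" using card_seteq[OF fin sub] by blast
    moreover have "orbit H x \<noteq> {x}"
    proof
      assume "orbit H x = {x}"
      then show False
        using \<open>\<not> card (orbit (pstab H \<Gamma>) x) \<le> n - 1\<close> \<open>n \<ge> 2\<close> calculation by simp
    qed
    ultimately show ?thesis by blast
  qed
  obtain x z where xz: "\<And>i. z i \<noteq> x i" "\<And>i. z i \<in> orbit H (x i)"
      "\<And>i j. i \<noteq> j \<Longrightarrow> orbit H (x i) \<inter> orbit H (x j) = {}"
      "\<And>T. \<exists>g\<in>H. \<forall>i. g (x i) = (if i \<in> T then z i else x (i :: nat))"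
    by (rule independent_points[OF cnt H fin full]) (assumption, rule that)
  obtain q :: "nat \<times> bool \<Rightarrow> 'a" where q: "inj q" "infinite (- range q)" "preceq (flips q) H"
    by (rule flips_preceq_if_independent_points[OF H(1) xz])
  have "preceq H G" by (rule preceq_subset) (auto simp: H_def pstab_def)
  with q(3) have "preceq (flips q) G" by (rule preceq_trans)
  then show ?thesis by (rule that[OF q(1,2)])
qed

section \<open>Partitions with unbounded blocks\<close>

lemma unbounded_partition_avoiding:
  assumes "\<not> (\<exists>n :: nat. \<forall>\<Sigma>\<in>B. card \<Sigma> \<le> n)" "finite F"
  shows "\<exists>\<Sigma>\<in>B - F. card \<Sigma> > N"
proof (rule ccontr)
  assume "\<not> ?thesis"
  then have le: "card \<Sigma> \<le> N" if "\<Sigma> \<in> B - F" for \<Sigma> using that by (meson not_le)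
  have "card \<Sigma> \<le> N + (\<Sum>X\<in>F. card X)" if "\<Sigma> \<in> B" for \<Sigma>
  proof (cases "\<Sigma> \<in> F")
    case True
    then have "card \<Sigma> \<le> (\<Sum>X\<in>F. card X)" using assms(2) by (intro member_le_sum) auto
    then show ?thesis by simp
  next
    case False
    then show ?thesis using le[of \<Sigma>] that by simp
  qed
  then show False using assms(1) by blast
qed

lemma infinite_nontrivial_blocks:
  assumes "\<not> (\<exists>n :: nat. \<forall>\<Sigma>\<in>B. card \<Sigma> \<le> n)"
  shows "infinite {\<Sigma> \<in> B. card \<Sigma> > 1}"
proof
  assume "finite {\<Sigma> \<in> B. card \<Sigma> > 1}"
  from unbounded_partition_avoiding[OF assms this, of 1] show False by blast
qed

lemma orbit_S_part_bound:
  assumes "is_partition A" "\<And>\<Sigma>. \<Sigma> \<in> A \<Longrightarrow> finite \<Sigma> \<and> card \<Sigma> \<le> n"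
  shows "finite (orbit (S_part A) x) \<and> card (orbit (S_part A) x) \<le> n"
proof -
  obtain \<Sigma> where \<Sigma>: "\<Sigma> \<in> A" "x \<in> \<Sigma>" using assms(1) unfolding is_partition_def by blast
  have "orbit (S_part A) x \<subseteq> \<Sigma>" using \<Sigma> by (auto simp: orbit_def S_part_def)
  then show ?thesis using assms(2)[OF \<Sigma>(1)] by (meson card_mono finite_subset order_trans)
qed

text \<open>A large block disjoint from \<open>\<Gamma>\<close> lies in one orbit, because all
  transpositions inside it belong to the stabilizer. The size is stated for a subset because
  \<open>card\<close> of an infinite orbit would be 0; finiteness is supplied where the lemma is
  applied.\<close>

lemma S_part_unbounded_orbit:
  assumes B: "is_partition B" "\<not> (\<exists>n :: nat. \<forall>\<Sigma>\<in>B. card \<Sigma> \<le> n)" and "finite \<Gamma>"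
  shows "\<exists>x. \<exists>\<Sigma>\<subseteq>orbit (pstab (S_part B) \<Gamma>) x. card \<Sigma> > N"
proof -
  have uniq: "X = Y" if "X \<in> B" "Y \<in> B" "x \<in> X" "x \<in> Y" for X Y x
    using B(1) that unfolding is_partition_def by blast
  \<comment> \<open>The finitely many blocks that meet \<open>\<Gamma>\<close>.\<close>
  define F where "F = (\<lambda>x. THE \<Sigma>. \<Sigma> \<in> B \<and> x \<in> \<Sigma>) ` \<Gamma>"
  have F: "\<Sigma> \<in> F" if "\<Sigma> \<in> B" "x \<in> \<Sigma>" "x \<in> \<Gamma>" for \<Sigma> x
  proof -
    have "(THE \<Sigma>. \<Sigma> \<in> B \<and> x \<in> \<Sigma>) = \<Sigma>" using that uniq by (intro the_equality) blast+
    then show ?thesis unfolding F_def using that(3) by blast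
  qed
  obtain \<Sigma> where \<Sigma>: "\<Sigma> \<in> B" "\<Sigma> \<notin> F" "card \<Sigma> > N"
    using unbounded_partition_avoiding[OF B(2), of F N] assms(3) by (auto simp: F_def)
  obtain x where x: "x \<in> \<Sigma>" using \<Sigma>(3) by fastforce
  have "\<Sigma> \<subseteq> orbit (pstab (S_part B) \<Gamma>) x"
  proof
    fix y assume y: "y \<in> \<Sigma>"
    have "transpose x y \<in> S_part B"
    proof (rule S_part_invI)
      show "transpose x y w \<in> X" if "X \<in> B" "w \<in> X" for X w
        using that x y \<Sigma>(1) uniq unfolding transpose_def by metis
    qed simp_all
    moreover have "transpose x y w = w" if "w \<in> \<Gamma>" for w
      using that F[OF \<Sigma>(1)] \<Sigma>(2) x y by (metis transpose_apply_other)
    ultimately have "transpose x y \<in> pstab (S_part B) \<Gamma>" by (simp add: pstab_def)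
    then have "transpose x y x \<in> orbit (pstab (S_part B) \<Gamma>) x" unfolding orbit_eq_image by (rule imageI)
    then show "y \<in> orbit (pstab (S_part B) \<Gamma>) x" by simp
  qed
  then show ?thesis using \<Sigma>(3) by blast
qed

theorem theorem7p2:
  assumes "countable (UNIV :: 'a set)" and "infinite (UNIV :: 'a set)"
  shows "(\<forall>A\<in>(Qparts :: 'a set set set). \<forall>B\<in>Qparts. approx (S_part A) (S_part B))
    \<and> (\<forall>G :: ('a \<Rightarrow> 'a) set. is_subgroup G \<and> closed_in_Sym G \<longrightarrow>
         (\<forall>A\<in>Qparts. approx G (S_part A) \<longleftrightarrow>
            ((\<exists>\<Gamma> n. finite \<Gamma> \<and> n > (0::nat) \<and>
                 (\<forall>x. finite (orbit (pstab G \<Gamma>) x) \<and> card (orbit (pstab G \<Gamma>) x) \<le> n))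
             \<and> \<not> (\<exists>\<Gamma>. finite \<Gamma> \<and> pstab G \<Gamma> = {id}))))
    \<and> (\<forall>A\<in>(Qparts :: 'a set set set). \<forall>B. is_partition B \<and> (\<forall>\<Sigma>\<in>B. finite \<Sigma>)
         \<and> \<not> (\<exists>n::nat. \<forall>\<Sigma>\<in>B. card \<Sigma> \<le> n) \<longrightarrow> prec (S_part A) (S_part B))"
proof -
  have QD: "is_partition A" "\<exists>n. \<forall>\<Sigma>\<in>A. finite \<Sigma> \<and> card \<Sigma> \<le> n" "infinite {\<Sigma> \<in> A. card \<Sigma> > 1}"
    if "A \<in> Qparts" for A :: "'a set set"
    using that by (simp_all add: Qparts_def)
  have le_flips: "preceq (S_part A) (flips q)"
    if "A \<in> Qparts" "inj q" "infinite (- range q)" for A :: "'a set set" and q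
    using QD(2)[OF that(1)] S_part_preceq_flips[OF assms(1) that(2,3) QD(1)[OF that(1)]] by blast
  \<comment> \<open>Covers both the mutual equivalence within \<open>Qparts\<close> and the
    comparison with a partition into unbounded blocks.\<close>
  have le_S_part: "preceq (S_part A) (S_part B)"
    if A: "A \<in> Qparts" and B: "is_partition B" "infinite {\<Sigma> \<in> B. card \<Sigma> > 1}" for A B :: "'a set set"
  proof -
    obtain q where q: "inj q" "infinite (- range q)" "flips q \<subseteq> S_part B"
      by (rule flips_subset_S_part[OF B])
    show ?thesis by (rule preceq_trans[OF le_flips[OF A q(1,2)] preceq_subset[OF q(3)]])
  qed
  have bounded_if: "\<exists>\<Gamma> N. finite \<Gamma> \<and> (\<forall>x. finite (orbit (pstab G \<Gamma>) x) \<and> card (orbit (pstab G \<Gamma>) x) \<le> N)"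
    if A: "A \<in> Qparts" and G: "is_subgroup G" "closed_in_Sym G" and le: "preceq G (S_part A)" for G and A :: "'a set set"
  proof -
    obtain n where n: "\<And>\<Sigma>. \<Sigma> \<in> A \<Longrightarrow> finite \<Sigma> \<and> card \<Sigma> \<le> n" using QD(2)[OF A] by blast
    show ?thesis
      using bounded_orbits_if_preceq[OF assms(1) G is_subgroup_S_part
          orbit_S_part_bound[OF QD(1)[OF A] n] le] .
  qed
  have 1: "approx (S_part A) (S_part B)" if "A \<in> Qparts" "B \<in> Qparts" for A B :: "'a set set"
    unfolding approx_def using le_S_part QD that by blast
  have 2: "approx G (S_part A) \<longleftrightarrow>
      (\<exists>\<Gamma> n. finite \<Gamma> \<and> n > 0 \<and>
         (\<forall>x. finite (orbit (pstab G \<Gamma>) x) \<and> card (orbit (pstab G \<Gamma>) x) \<le> n))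
      \<and> \<not> (\<exists>\<Gamma>. finite \<Gamma> \<and> pstab G \<Gamma> = {id})" (is "?L \<longleftrightarrow> ?R1 \<and> \<not> ?R2")
    if G: "is_subgroup G" "closed_in_Sym G" and A: "A \<in> Qparts" for G and A :: "'a set set"
  proof (intro iffI conjI notI)
    assume L: ?L
    then obtain \<Gamma> N where "finite \<Gamma>"
        "\<And>x. finite (orbit (pstab G \<Gamma>) x) \<and> card (orbit (pstab G \<Gamma>) x) \<le> N"
      using bounded_if[OF A G] unfolding approx_def by blast
    \<comment> \<open>\<open>Suc N\<close> makes the bound positive.\<close>
    then show ?R1 by (intro exI[of _ \<Gamma>] exI[of _ "Suc N"]) (auto intro: le_SucI)
  next
    \<comment> \<open>A trivial stabilizer makes \<open>G\<close> countable, but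
      \<open>S_part A\<close> contains uncountably many flips.\<close>
    assume L: ?L and ?R2
    then have "countable G" using countable_if_pstab_trivial[OF assms(1) G(1)] by blast
    obtain U where U: "finite U" "S_part A \<subseteq> gen (G \<union> U)"
      using L unfolding approx_def preceq_def by blast
    obtain q where q: "inj q" "flips q \<subseteq> S_part A"
      by (rule flips_subset_S_part[OF QD(1,3)[OF A]])
    have "countable (gen (G \<union> U))"
      using \<open>countable G\<close> U(1) by (intro countable_gen) (simp add: countable_finite)
    then have "countable (flips q)" using countable_subset order_trans[OF q(2) U(2)] by blast
    then show False using uncountable_flips[OF q(1)] by blast
  next
    assume R: "?R1 \<and> \<not> ?R2"
    then obtain \<Gamma> n where \<Gamma>: "finite \<Gamma>"
        "\<And>x. finite (orbit (pstab G \<Gamma>) x) \<and> card (orbit (pstab G \<Gamma>) x) \<le> n" by blast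
    have "preceq G (S_part A)"
    proof -
      obtain q where q: "inj q" "infinite (- range q)" "flips q \<subseteq> S_part A"
        by (rule flips_subset_S_part[OF QD(1,3)[OF A]])
      show ?thesis
        by (rule preceq_trans[OF preceq_flips_if_bounded_orbits[OF assms q(1,2) G(1) \<Gamma>]
              preceq_subset[OF q(3)]])
    qed
    moreover have "preceq (S_part A) G"
    proof -
      obtain q :: "nat \<times> bool \<Rightarrow> 'a" where q: "inj q" "infinite (- range q)" "preceq (flips q) G"
        by (rule flips_preceq_if_bounded_orbits[OF assms(1) G \<Gamma>]) (use R in blast)+
      show ?thesis by (rule preceq_trans[OF le_flips[OF A q(1,2)] q(3)])
    qed
    ultimately show ?L unfolding approx_def by blast
  qed
  have 3: "prec (S_part A) (S_part B)"
    if A: "A \<in> Qparts" and B: "is_partition B" "\<forall>\<Sigma>\<in>B. finite \<Sigma>" "\<not> (\<exists>n::nat. \<forall>\<Sigma>\<in>B. card \<Sigma> \<le> n)"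
    for A B :: "'a set set"
  proof -
    \<comment> \<open>Lying below \<open>S_part A\<close> would bound the orbits of some stabilizer
      in the closed group \<open>S_part B\<close>, yet every such stabilizer still has arbitrarily
      large orbits.\<close>
    have "\<not> preceq (S_part B) (S_part A)"
    proof
      assume "preceq (S_part B) (S_part A)"
      moreover have "closed_in_Sym (S_part B)" using closed_in_Sym_S_part B(2) by blast
      ultimately obtain \<Gamma> N where \<Gamma>: "finite \<Gamma>" "\<And>x. finite (orbit (pstab (S_part B) \<Gamma>) x) \<and>
          card (orbit (pstab (S_part B) \<Gamma>) x) \<le> N"
        using bounded_if[OF A is_subgroup_S_part] by blast
      obtain x \<Sigma> where "\<Sigma> \<subseteq> orbit (pstab (S_part B) \<Gamma>) x" "card \<Sigma> > N"
        using S_part_unbounded_orbit[OF B(1,3) \<Gamma>(1), of N] by blast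
      moreover from this have "card \<Sigma> \<le> card (orbit (pstab (S_part B) \<Gamma>) x)"
        using \<Gamma>(2) by (intro card_mono) auto
      ultimately show False using \<Gamma>(2)[of x] by linarith
    qed
    then show ?thesis
      unfolding prec_def using le_S_part[OF A B(1) infinite_nontrivial_blocks[OF B(3)]] by blast
  qed
  show ?thesis
    by (intro conjI ballI allI impI; (elim conjE)?; rule 1 2 3; assumption)
qed

end
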